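(* Let $\lambda$ be a strict partition of $n$. Then, as formal power series in $t$, $$Q_\lambda(t^\bullet)=\frac{t^{n(\lambda)}\prod_{(i,j)\in\lambda^*}(1+t^{c_{ij}})}{\prod_{(i,j)\in\lambda^*}(1-t^{h^*_{ij}})},$$ where $Q_\lambda(t^\bullet)=Q_\lambda(1,t,t^2,\ldots)$ is the principal specialization of the Schur $Q$-function.
   Context: A strict partition $\lambda=(\lambda_1>\lambda_2>\cdots>\lambda_\ell>0)$ of $n$ has length $\ell(\lambda)=\ell$, and $n(\lambda)=\sum_{i\ge1}(i-1)\lambda_i$. Its shifted diagram is $\lambda^*=\{(i,j): 1\le i\le\ell(\lambda),\ i\le j\le\lambda_i+i-1\}$. The content of $(i,j)\in\lambda^*$ is $c_{ij}=j-i$. The double partition $\widetilde\lambda$ is the partition with Frobenius notation $(\lambda_1,\dots,\lambda_\ell\,|\,\lambda_1-1,\dots,\lambda_\ell-1)$ (so for $1\le i\le\ell$ it has $\lambda_i$ cells in row $i$ strictly right of $(i,i)$ and $\lambda_i-1$ cells in column $i$ strictly below $(i,i)$). The shifted diagram $\lambda^*$ is identified with the part of $\widetilde\lambda$ strictly above the main diagonal, $(i,j)\in\lambda^*$ corresponding to the cell $(i,j+1)$ of $\widetilde\lambda$; the shifted hook length $h^*_{ij}$ is the ordinary hook length in $\widetilde\lambda$ of that corresponding cell. (Example: for $\lambda=(4,2,1)$ the rows of shifted hook lengths are $6,5,4,1$; $3,2$; $1$.) Schur $Q$-functions: for $m\ge\ell=\ell(\lambda)$, $Q_\lambda(z_1,\dots,z_m)=2^{\ell}\sum_{w\in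 S_m/S_{m-\ell}}w\big(z_1^{\lambda_1}\cdots z_\ell^{\lambda_\ell}\prod_{1\le i\le\ell}\prod_{i<j\le m}\frac{z_i+z_j}{z_i-z_j}\big)$, where $S_m$ permutes the variables and $S_{m-\ell}$ permutes $z_{\ell+1},\dots,z_m$; this stabilizes as $m\to\infty$ and gives the symmetric function $Q_\lambda(z_1,z_2,\ldots)$. *)

theory Defs
  imports
    "HOL-Library.Poly_Mapping"
    "HOL-Computational_Algebra.Computational_Algebra"
    "HOL-Combinatorics.Permutations"
begin

text \<open>
  All indices start at 0: the part \<open>\<lambda> ! i\<close> of a list is the usual \<open>\<lambda>\<^sub>i\<^sub>+\<^sub>1\<close>, the variable
  number \<open>i\<close> is the usual \<open>z\<^sub>i\<^sub>+\<^sub>1\<close>, and a cell \<open>(i, j)\<close> is the usual cell \<open>(i + 1, j + 1)\<close>.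
\<close>

section \<open>Strict partitions and their diagrams\<close>

definition strict_partition :: "nat list \<Rightarrow> nat \<Rightarrow> bool" where
  "strict_partition lam n \<longleftrightarrow>
     sorted_wrt (>) lam \<and> (\<forall>p\<in>set lam. p > 0) \<and> sum_list lam = n"

definition partition_n :: "nat list \<Rightarrow> nat" where
  "partition_n lam = (\<Sum>i<length lam. i * lam ! i)"

definition shifted_diagram :: "nat list \<Rightarrow> (nat \<times> nat) set" where
  "shifted_diagram lam = {(i, j). i < length lam \<and> i \<le> j \<and> j < lam ! i + i}"

text \<open>The subtraction does not truncate on the cells of a shifted diagram, where \<open>i \<le> j\<close>.\<close>

definition cell_content :: "nat \<times> nat \<Rightarrow> nat" where
  "cell_content = (\<lambda>(i, j). j - i)"

text \<open>The (ordinary) diagram with Frobenius notation \<open>(a | b)\<close>: diagonal, arms and legs.\<close>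

definition frobenius_diagram :: "nat list \<Rightarrow> nat list \<Rightarrow> (nat \<times> nat) set" where
  "frobenius_diagram a b =
     {(i, i) | i. i < length a}
     \<union> {(i, j). i < length a \<and> i < j \<and> j \<le> i + a ! i}
     \<union> {(i, j). j < length b \<and> j < i \<and> i \<le> j + b ! j}"

definition double_diagram :: "nat list \<Rightarrow> (nat \<times> nat) set" where
  "double_diagram lam = frobenius_diagram lam (map (\<lambda>p. p - 1) lam)"

definition hook_length :: "(nat \<times> nat) set \<Rightarrow> nat \<times> nat \<Rightarrow> nat" where
  "hook_length D = (\<lambda>(i, j).
     card {j'. j < j' \<and> (i, j') \<in> D} + card {i'. i < i' \<and> (i', j) \<in> D} + 1)"

definition shifted_hook_length :: "nat list \<Rightarrow> nat \<times> nat \<Rightarrow> nat" where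
  "shifted_hook_length lam = (\<lambda>(i, j). hook_length (double_diagram lam) (i, j + 1))"

section \<open>Schur Q-functions\<close>

text \<open>
  Polynomials in the variables \<open>z\<^sub>0, z\<^sub>1, \<dots>\<close> are finitely supported maps from monomials
  (finitely supported exponent vectors) to coefficients; multiplication is convolution.
\<close>

type_synonym monomial = "nat \<Rightarrow>\<^sub>0 nat"
type_synonym mpolynomial = "monomial \<Rightarrow>\<^sub>0 rat"

definition variable :: "nat \<Rightarrow> mpolynomial" where
  "variable i = Poly_Mapping.single (Poly_Mapping.single i 1) 1"

definition z_var :: "nat \<Rightarrow> mpolynomial fract" where
  "z_var i = to_fract (variable i)"

text \<open>
  The result of applying the permutation \<open>w\<close> of the variables to the rational function
  \<open>\<Prod>i<l. z\<^sub>i ^ \<lambda>\<^sub>i * (\<Prod>i<j<m. (z\<^sub>i + z\<^sub>j) / (z\<^sub>i - z\<^sub>j))\<close>, that is, of replacing each \<open>z\<^sub>i\<close> by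
  \<open>z\<^bsub>w i\<^esub>\<close>.
\<close>

definition schurQ_summand :: "nat list \<Rightarrow> nat \<Rightarrow> (nat \<Rightarrow> nat) \<Rightarrow> mpolynomial fract" where
  "schurQ_summand lam m w =
     (\<Prod>i<length lam. z_var (w i) ^ (lam ! i)) *
     (\<Prod>i<length lam. \<Prod>j\<in>{i<..<m}.
        (z_var (w i) + z_var (w j)) / (z_var (w i) - z_var (w j)))"

text \<open>The left cosets of the group of permutations of \<open>{l..<m}\<close> in that of \<open>{..<m}\<close>.\<close>

definition sym_cosets :: "nat \<Rightarrow> nat \<Rightarrow> (nat \<Rightarrow> nat) set set" where
  "sym_cosets m l =
     (\<lambda>w. (\<lambda>v. w \<circ> v) ` {v. v permutes {l..<m}}) ` {w. w permutes {..<m}}"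

text \<open>
  The summand takes the same value on all elements of a coset, so the choice of the
  representative is immaterial.
\<close>

definition schurQ_fract :: "nat list \<Rightarrow> nat \<Rightarrow> mpolynomial fract" where
  "schurQ_fract lam m =
     2 ^ length lam *
     (\<Sum>C\<in>sym_cosets m (length lam). schurQ_summand lam m (SOME w. w \<in> C))"

text \<open>For \<open>m \<ge> length lam\<close> the rational function above is a polynomial, namely this one.\<close>

definition schurQ_poly :: "nat list \<Rightarrow> nat \<Rightarrow> mpolynomial" where
  "schurQ_poly lam m = (THE P. to_fract P = schurQ_fract lam m)"

text \<open>
  The symmetric function in infinitely many variables, as a formal power series (an arbitrary
  map from monomials to coefficients): each coefficient is the stable value of the
  coefficients of the polynomials in \<open>m\<close> variables.
\<close>

definition schurQ :: "nat list \<Rightarrow> monomial \<Rightarrow> rat" where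
  "schurQ lam a =
     (THE c. \<forall>\<^sub>F m in sequentially. Poly_Mapping.lookup (schurQ_poly lam m) a = c)"

text \<open>
  The substitution \<open>z\<^sub>i := t ^ i\<close>. It sends the monomial with exponent vector \<open>a\<close> to
  \<open>t ^ (\<Sum>i. i * a\<^sub>i)\<close>; if \<open>F\<close> has bounded degree, then only finitely many monomials contribute to
  each power of \<open>t\<close>.
\<close>

definition principal_spec :: "(monomial \<Rightarrow> rat) \<Rightarrow> rat fps" where
  "principal_spec F = Abs_fps (\<lambda>k.
     \<Sum>a | F a \<noteq> 0 \<and> (\<Sum>i\<in>Poly_Mapping.keys a. i * Poly_Mapping.lookup a i) = k. F a)"

end

theory Submission
  imports Defs
begin

text \<open>
  The principal specialization of a Schur Q-function is computed from its Pfaffian expansion.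

  Write \<open>a(x, y) = (y - x) / (x + y)\<close>. Schur's Pfaffian evaluation says that
  \<open>\<Prod>\<^bsub>i<j\<^esub> a(x\<^sub>i, x\<^sub>j)\<close> is the Pfaffian of the matrix of all \<open>a(x\<^sub>i, x\<^sub>j)\<close>, bordered by a column of
  ones if the number of points is odd; the proof uses only its expansion along the first row
  (\<open>schur_pfaffian\<close>), which is a partial fraction identity. It is used twice, with two different
  choices of points.

  With the variables as points: the sum over cosets that defines \<open>Q\<^sub>\<lambda>(z\<^sub>0, \<dots>, z\<^bsub>m-1\<^esub>)\<close> is a sum over
  tuples of variables of a product of one-variable weights and of factors \<open>a(z\<^sub>b, z\<^sub>c)\<close>. Expanding
  these factors expresses it through tuples of length one and two
  (\<open>generic_variables.tuple_sum_eq_pfaffian\<close>). The sums over a single variable are the coefficients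
  \<open>q\<^sub>r\<close> of \<open>\<Prod>\<^sub>a (1 + z\<^sub>a y) / (1 - z\<^sub>a y)\<close>, and the sums over pairs are polynomials in the \<open>q\<^sub>r\<close> with
  integer coefficients. So \<open>Q\<^sub>\<lambda>\<close> is one fixed polynomial expression \<open>pfaffian_Q\<close> in the \<open>q\<^sub>r\<close>. This one
  fact shows that the rational function is a polynomial, that its coefficients stabilize (adjoining
  the variable \<open>z\<^sub>m\<close> changes each \<open>q\<^sub>r\<close> by a multiple of \<open>z\<^sub>m\<close>), and that substituting \<open>z\<^sub>i = t ^ i\<close> in
  \<open>Q\<^sub>\<lambda>\<close> amounts to substituting it in the \<open>q\<^sub>r\<close>. The resulting value of \<open>q\<^sub>r\<close> is
  \<open>\<Prod>\<^bsub>i<r\<^esub> (1 + t ^ i) / (1 - t ^ (i + 1))\<close> modulo \<open>t ^ m\<close>: comparing \<open>y\<close> with \<open>t y\<close> in the generating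
  function, almost all factors cancel (\<open>one_row_principal_recurrence\<close>).

  With the points \<open>x\<^sub>i = (1 + t ^ \<lambda>\<^sub>i) / (1 - t ^ \<lambda>\<^sub>i)\<close>: then
  \<open>a(x\<^sub>i, x\<^sub>j) = (t ^ \<lambda>\<^sub>j - t ^ \<lambda>\<^sub>i) / (1 - t ^ (\<lambda>\<^sub>i + \<lambda>\<^sub>j))\<close>, and for the specialized \<open>q\<^sub>r\<close> the two-row
  expressions are \<open>q\<^sub>r q\<^sub>s a(x\<^sub>r, x\<^sub>s)\<close>. The same Pfaffian expansion, read backwards, gives
  \<open>Q\<^sub>\<lambda> = \<Prod>\<^sub>i q(\<lambda>\<^sub>i) \<Prod>\<^bsub>i<j\<^esub> a(x\<^sub>i, x\<^sub>j)\<close> (\<open>principal_point.pfaffian_Q_principal\<close>).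

  The hook formula is a rewriting of this product: the hook lengths in row \<open>i\<close> of the shifted
  diagram together with the differences \<open>\<lambda>\<^sub>i - \<lambda>\<^sub>k\<close> are the numbers \<open>1, \<dots>, \<lambda>\<^sub>i\<close> together with the sums
  \<open>\<lambda>\<^sub>i + \<lambda>\<^sub>k\<close>, where \<open>k > i\<close> (\<open>prod_shifted_hooks_row\<close>).
\<close>

section \<open>Partial fractions and Schur's Pfaffian\<close>

lemma degree_prod_linear_le:
  fixes c :: "'a \<Rightarrow> 'b::comm_ring_1"
  assumes "finite V"
  shows "degree (\<Prod>v\<in>V. [:1, c v:]) \<le> card V"
  using assms
proof (induction V rule: finite_induct)
  case (insert v V)
  have "degree ([:1, c v:] * (\<Prod>v\<in>V. [:1, c v:])) \<le> degree [:1, c v:] + degree (\<Prod>v\<in>V. [:1, c v:])"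
    by (rule degree_mult_le)
  also have "\<dots> \<le> 1 + card V"
    using insert.IH by (intro add_mono) auto
  finally show ?case
    using insert.hyps by (simp del: mult_pCons_left)
qed simp

lemma coeff_prod_linear:
  fixes c :: "'a \<Rightarrow> 'b::comm_ring_1"
  assumes "finite V"
  shows "coeff (\<Prod>v\<in>V. [:1, c v:]) (card V) = (\<Prod>v\<in>V. c v)"
  using assms
proof (induction V rule: finite_induct)
  case (insert v V)
  have "coeff (\<Prod>v\<in>V. [:1, c v:]) (Suc (card V)) = 0"
    using degree_prod_linear_le[OF insert.hyps(1), of c] by (intro coeff_eq_0) simp
  then show ?case
    using insert by simp
qed simp

text \<open>
  Up to an elementary factor, the residue at \<open>y = 1 / v\<close> of the rational function
  \<open>\<Prod>u\<in>V. (1 + u * y) / (1 - u * y)\<close>.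
\<close>

definition residue_weight :: "'a::field set \<Rightarrow> 'a \<Rightarrow> 'a" where
  "residue_weight V v = (\<Prod>u\<in>V - {v}. (v + u) / (v - u))"

text \<open>
  The partial fraction decomposition
  \<open>\<Prod>v\<in>V. (1 + v y) / (1 - v y) = (-1) ^ card V + (\<Sum>v\<in>V. 2 * residue_weight V v / (1 - v y))\<close>,
  with denominators cleared. Both sides have degree at most \<open>card V\<close>, the same coefficient in that
  degree, and the same value at each of the \<open>card V\<close> points \<open>1 / v\<close>, where only the summand of \<open>v\<close>
  survives.
\<close>

lemma partial_fractions_poly:
  fixes V :: "'a::field set"
  assumes fin: "finite V" and nz: "\<And>u v. u \<in> V \<Longrightarrow> v \<in> V \<Longrightarrow> u + v \<noteq> 0"
  shows "(\<Prod>v\<in>V. [:1, v:]) =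
    smult ((-1) ^ card V) (\<Prod>v\<in>V. [:1, - v:]) +
    (\<Sum>v\<in>V. smult (2 * residue_weight V v) (\<Prod>u\<in>V - {v}. [:1, - u:]))"
    (is "?L = ?R1 + ?R2")
proof -
  have nz0: "v \<noteq> 0" if "v \<in> V" for v
    using nz[OF that that] by auto
  have deg2: "degree (\<Prod>u\<in>V - {v}. [:1, - u:]) < card V" if "v \<in> V" for v
    using degree_prod_linear_le[of "V - {v}" "\<lambda>u. - u"] fin that
    by (metis card_Diff1_less finite_Diff le_less_trans)
  have deg2': "degree (smult (2 * residue_weight V v) (\<Prod>u\<in>V - {v}. [:1, - u:])) < card V"
    if "v \<in> V" for v
    using deg2[OF that] by (meson degree_smult_le le_less_trans)
  show ?thesis
  proof (rule poly_eqI_degree_lead_coeff[where n = "card V" and A = "inverse ` V"])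
    show "degree ?L \<le> card V"
      by (rule degree_prod_linear_le[OF fin])
    have "degree ?R1 \<le> card V"
      using degree_prod_linear_le[OF fin, of uminus] degree_smult_le le_trans by blast
    moreover have "degree ?R2 \<le> card V"
      using deg2' by (intro degree_sum_le fin) (simp add: less_imp_le)
    ultimately show "degree (?R1 + ?R2) \<le> card V"
      by (rule degree_add_le)
    have "coeff ?R2 (card V) = 0"
      using deg2' by (auto simp: coeff_sum coeff_eq_0 intro!: sum.neutral simp del: coeff_smult)
    moreover have "coeff ?R1 (card V) = (\<Prod>v\<in>V. v)"
      by (simp add: coeff_prod_linear[OF fin] prod_uminus flip: power_add mult.assoc)
    ultimately show "coeff ?L (card V) = coeff (?R1 + ?R2) (card V)"
      by (simp add: coeff_prod_linear[OF fin, where c = "\<lambda>v. v"])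
    show "card V \<le> card (inverse ` V)"
      by (simp add: card_image inj_on_def)
    fix y assume "y \<in> inverse ` V"
    then obtain v where v: "v \<in> V" and y: "y = inverse v"
      by auto
    have split: "prod f V = f v * prod f (V - {v})" for f :: "'a \<Rightarrow> 'a"
      by (rule prod.remove[OF fin v])
    have "poly ?L y = (\<Prod>u\<in>V. (v + u) / v)"
      using nz0[OF v] by (auto simp: poly_prod y field_simps intro!: prod.cong)
    also have "\<dots> = 2 * (\<Prod>u\<in>V - {v}. (v + u) / v)"
      using nz0[OF v] by (subst split) (simp add: field_simps)
    also have "(\<Prod>u\<in>V - {v}. (v + u) / v) = residue_weight V v * (\<Prod>u\<in>V - {v}. (v - u) / v)"
      unfolding residue_weight_def prod.distrib[symmetric]
      by (intro prod.cong) auto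
    also have "(\<Prod>u\<in>V - {v}. (v - u) / v) = (\<Prod>u\<in>V - {v}. 1 - y * u)"
      using nz0[OF v] by (intro prod.cong) (auto simp: y field_simps)
    finally have L: "poly ?L y = 2 * residue_weight V v * (\<Prod>u\<in>V - {v}. 1 - y * u)"
      by (simp add: mult.assoc)
    have R1: "poly ?R1 y = 0"
      using fin v nz0[OF v] by (auto simp: poly_prod y intro!: prod_zero bexI[of _ v])
    have "poly ?R2 y = (\<Sum>w\<in>V. 2 * residue_weight V w * (\<Prod>u\<in>V - {w}. 1 - y * u))"
      by (simp add: poly_sum poly_prod)
    also have "\<dots> = (\<Sum>w\<in>V. if w = v then 2 * residue_weight V v * (\<Prod>u\<in>V - {v}. 1 - y * u) else 0)"
    proof (intro sum.cong refl)
      fix w assume "w \<in> V"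
      have "(\<Prod>u\<in>V - {w}. 1 - y * u) = 0" if "w \<noteq> v"
        using fin v nz0[OF v] that by (auto simp: y intro!: prod_zero bexI[of _ v])
      then show "2 * residue_weight V w * (\<Prod>u\<in>V - {w}. 1 - y * u) =
        (if w = v then 2 * residue_weight V v * (\<Prod>u\<in>V - {v}. 1 - y * u) else 0)"
        by auto
    qed
    also have "\<dots> = poly ?L y"
      using fin v by (simp add: L)
    finally show "poly ?L y = poly (?R1 + ?R2) y"
      using R1 by simp
  qed
qed

text \<open>
  The partial fraction decomposition evaluated at \<open>y = 0\<close>.
\<close>

lemma sum_residue_weight:
  fixes V :: "'a::field set"
  assumes fin: "finite V" and nz: "\<And>u v. u \<in> V \<Longrightarrow> v \<in> V \<Longrightarrow> u + v \<noteq> 0"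
  shows "(\<Sum>v\<in>V. 2 * residue_weight V v) = 1 - (-1) ^ card V"
  using arg_cong[OF partial_fractions_poly[OF assms], of "\<lambda>p. poly p 0"]
  by (simp add: poly_prod poly_sum algebra_simps)

definition schur_factor :: "'a::field \<Rightarrow> 'a \<Rightarrow> 'a" where
  "schur_factor x y = (y - x) / (x + y)"

lemma schur_factor_same [simp]: "schur_factor x x = 0"
  by (simp add: schur_factor_def)

lemma schur_factor_swap: "schur_factor y x = - schur_factor x y"
  by (simp add: schur_factor_def field_simps minus_divide_left)

text \<open>
  The partial fraction decomposition evaluated at \<open>y = - 1 / X\<close>.
\<close>

lemma partial_fractions:
  fixes V :: "'a::field set"
  assumes fin: "finite V" and nz: "\<And>u v. u \<in> V \<Longrightarrow> v \<in> V \<Longrightarrow> u + v \<noteq> 0"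
    and X: "X \<noteq> 0" "\<And>v. v \<in> V \<Longrightarrow> X + v \<noteq> 0"
  shows "(\<Prod>v\<in>V. schur_factor X v) =
    1 + (-1) ^ card V * (\<Sum>v\<in>V. 2 * residue_weight V v * (X / (X + v)))"
proof -
  let ?D = "\<Prod>v\<in>V. (X + v) / X"
  have D: "?D \<noteq> 0"
    using fin X by simp
  have "(\<Prod>v\<in>V. (X - v) / X) = (-1) ^ card V * ?D +
      (\<Sum>v\<in>V. 2 * residue_weight V v * (\<Prod>u\<in>V - {v}. (X + u) / X))"
    using arg_cong[OF partial_fractions_poly[OF fin nz], of "\<lambda>p. poly p (- inverse X)"] X(1)
    by (simp add: poly_prod poly_sum field_simps)
  moreover have "(\<Prod>u\<in>V - {v}. (X + u) / X) = ?D * (X / (X + v))" if "v \<in> V" for v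
    using X that by (simp add: prod.remove[OF fin that])
  ultimately have "(\<Prod>v\<in>V. (X - v) / X) =
      ?D * ((-1) ^ card V + (\<Sum>v\<in>V. 2 * residue_weight V v * (X / (X + v))))"
    by (simp add: distrib_left sum_distrib_left mult_ac)
  moreover have "(\<Prod>v\<in>V. (X - v) / X) = (\<Prod>v\<in>V. schur_factor X v) * (-1) ^ card V * ?D"
  proof -
    have "(\<Prod>v\<in>V. (X - v) / X) = (\<Prod>v\<in>V. schur_factor X v * (-1) * ((X + v) / X))"
    proof (intro prod.cong refl)
      fix v assume "v \<in> V"
      then show "(X - v) / X = schur_factor X v * (-1) * ((X + v) / X)"
        using X(2)[of v] by (simp add: schur_factor_def)
    qed
    also have "\<dots> = (\<Prod>v\<in>V. schur_factor X v) * (\<Prod>v\<in>V. -1) * ?D"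
      unfolding prod.distrib ..
    finally show ?thesis by simp
  qed
  ultimately have "(\<Prod>v\<in>V. schur_factor X v) * (-1) ^ card V =
      (-1) ^ card V + (\<Sum>v\<in>V. 2 * residue_weight V v * (X / (X + v)))"
    using D by simp
  then have "(\<Prod>v\<in>V. schur_factor X v) * (-1) ^ card V * (-1) ^ card V =
      ((-1) ^ card V + (\<Sum>v\<in>V. 2 * residue_weight V v * (X / (X + v)))) * (-1) ^ card V"
    by simp
  then show ?thesis
    by (simp add: algebra_simps flip: power_add)
qed

text \<open>
  The previous expansion written in terms of the factors themselves, by
  \<open>2 * X / (X + v) = 1 - schur_factor X v\<close>; the constants add up to 1 or 0 by \<open>sum_residue_weight\<close>.
\<close>

lemma prod_schur_factor_expand:
  fixes V :: "'a::field set"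
  assumes fin: "finite V" and nz: "\<And>u v. u \<in> V \<Longrightarrow> v \<in> V \<Longrightarrow> u + v \<noteq> 0"
    and X: "X + X \<noteq> 0" "\<And>v. v \<in> V \<Longrightarrow> X + v \<noteq> 0"
  shows "(\<Prod>v\<in>V. schur_factor X v) = of_bool (even (card V)) -
    (-1) ^ card V * (\<Sum>v\<in>V. residue_weight V v * schur_factor X v)"
proof -
  have two: "(2::'a) \<noteq> 0" and X0: "X \<noteq> 0"
    using X(1) by (auto simp flip: mult_2)
  have "residue_weight V v * schur_factor X v =
      residue_weight V v - 2 * residue_weight V v * (X / (X + v))" if "v \<in> V" for v
    using X(2)[OF that] by (simp add: schur_factor_def field_simps)
  then have *: "(\<Sum>v\<in>V. residue_weight V v * schur_factor X v) = (\<Sum>v\<in>V. residue_weight V v) -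
      (\<Sum>v\<in>V. 2 * residue_weight V v * (X / (X + v)))"
    by (simp add: sum_subtractf)
  have "2 * (\<Sum>v\<in>V. residue_weight V v) = 1 - (-1) ^ card V"
    using sum_residue_weight[OF fin nz] by (simp add: sum_distrib_left)
  then have S: "(\<Sum>v\<in>V. residue_weight V v) = of_bool (odd (card V))"
    using two by (cases "even (card V)") auto
  show ?thesis
    using partial_fractions[OF fin nz X0 X(2)] unfolding * S
    by (cases "even (card V)") simp_all
qed

primrec schur_prod :: "'a::field list \<Rightarrow> 'a" where
  "schur_prod [] = 1"
| "schur_prod (x # xs) = (\<Prod>y\<leftarrow>xs. schur_factor x y) * schur_prod xs"

definition delete_nth :: "nat \<Rightarrow> 'a list \<Rightarrow> 'a list" where
  "delete_nth j xs = take j xs @ drop (Suc j) xs"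

lemma length_delete_nth [simp]: "j < length xs \<Longrightarrow> length (delete_nth j xs) = length xs - 1"
  by (simp add: delete_nth_def)

lemma map_delete_nth: "map f (delete_nth j xs) = delete_nth j (map f xs)"
  by (simp add: delete_nth_def take_map drop_map)

lemma set_delete_nth: "set (delete_nth j xs) \<subseteq> set xs"
  by (auto simp: delete_nth_def dest: in_set_takeD in_set_dropD)

lemma delete_nth_append_Cons [simp]: "delete_nth (length xs) (xs @ y # ys) = xs @ ys"
  by (simp add: delete_nth_def)

text \<open>
  Antisymmetry in the points, in the form of the sign of a cyclic shift.
\<close>

lemma schur_prod_move_to_front:
  "schur_prod (xs @ y # ys) = (-1) ^ length xs * schur_prod (y # xs @ ys)"
proof (induction xs)
  case (Cons x xs)
  then show ?case
    by (simp add: schur_factor_swap[of x y] mult_ac)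
qed simp

lemma schur_prod_eq_0:
  assumes "\<not> distinct xs"
  shows "schur_prod xs = 0"
proof -
  obtain us vs ws y where "xs = us @ [y] @ vs @ [y] @ ws"
    using not_distinct_decomp[OF assms] by blast
  then show ?thesis
    using schur_prod_move_to_front[of us y "vs @ y # ws"] by simp
qed

lemma schur_prod_delete_nth:
  assumes "distinct xs" and nz: "\<And>x y. x \<in> set xs \<Longrightarrow> y \<in> set xs \<Longrightarrow> x + y \<noteq> 0"
    and j: "j < length xs"
  shows "schur_prod (delete_nth j xs) =
    (-1) ^ j * (-1) ^ (length xs - 1) * residue_weight (set xs) (xs ! j) * schur_prod xs"
proof -
  define us y vs where "us = take j xs" and "y = xs ! j" and "vs = drop (Suc j) xs"
  have xs: "xs = us @ y # vs" and len: "length us = j"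
    using j by (simp_all add: us_def y_def vs_def id_take_nth_drop)
  have S: "set xs - {y} = set (us @ vs)" and dist: "distinct (us @ vs)" and y: "y \<notin> set (us @ vs)"
    using assms(1) by (auto simp: xs)
  have "residue_weight (set xs) y * (\<Prod>u\<leftarrow>us @ vs. schur_factor y u) =
      (\<Prod>u\<in>set (us @ vs). (y + u) / (y - u) * schur_factor y u)"
    unfolding residue_weight_def S prod.distinct_set_conv_list[OF dist, symmetric] prod.distrib ..
  also have "\<dots> = (\<Prod>u\<in>set (us @ vs). -1)"
  proof (intro prod.cong refl)
    fix u assume u: "u \<in> set (us @ vs)"
    then have "u - y \<noteq> 0" "y - u \<noteq> 0" "y + u \<noteq> 0"
      using y nz[of y u] by (auto simp: xs)
    moreover have "u - y = - (y - u)" by simp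
    ultimately show "(y + u) / (y - u) * schur_factor y u = -1"
      unfolding schur_factor_def
      by (metis divide_minus_left mult.commute mult_minus_left nonzero_mult_divide_mult_cancel_left
          divide_self times_divide_times_eq mult_eq_0_iff)
  qed
  also have "\<dots> = (-1) ^ (length xs - 1)"
    using dist by (simp add: xs distinct_card[OF dist, simplified])
  finally have *: "residue_weight (set xs) y * (\<Prod>u\<leftarrow>us @ vs. schur_factor y u) =
      (-1) ^ (length xs - 1)" .
  have "(-1) ^ j * (-1) ^ (length xs - 1) * residue_weight (set xs) y * schur_prod xs =
      (-1) ^ j * (-1) ^ j * (-1) ^ (length xs - 1) *
      (residue_weight (set xs) y * (\<Prod>u\<leftarrow>us @ vs. schur_factor y u)) * schur_prod (us @ vs)"
    unfolding xs schur_prod_move_to_front by (simp add: len)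
  also have "\<dots> = schur_prod (us @ vs)"
    unfolding * by (simp flip: power_add mult_2)
  also have "us @ vs = delete_nth j xs"
    by (simp add: us_def vs_def delete_nth_def)
  finally show ?thesis
    by (simp add: y_def)
qed

text \<open>
  Multiplying the expansion of \<open>\<Prod>v. schur_factor X v\<close> by \<open>schur_prod xs\<close> cancels the residue of
  \<open>xs ! j\<close> against the factors that involve \<open>xs ! j\<close>.
\<close>

lemma schur_pfaffian_distinct:
  assumes "distinct xs" and nz: "\<And>x y. x \<in> set (X # xs) \<Longrightarrow> y \<in> set (X # xs) \<Longrightarrow> x + y \<noteq> 0"
  shows "schur_prod (X # xs) = of_bool (even (length xs)) * schur_prod xs +
    (\<Sum>j<length xs. (-1) ^ j * schur_factor X (xs ! j) * schur_prod (delete_nth j xs))"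
proof -
  have bij: "bij_betw ((!) xs) {..<length xs} (set xs)"
    by (rule bij_betw_nth[OF assms(1)]) auto
  have "schur_prod (X # xs) = (\<Prod>v\<in>set xs. schur_factor X v) * schur_prod xs"
    by (simp add: prod.distinct_set_conv_list[OF assms(1), symmetric])
  also have "(\<Prod>v\<in>set xs. schur_factor X v) = of_bool (even (card (set xs))) -
      (-1) ^ card (set xs) * (\<Sum>v\<in>set xs. residue_weight (set xs) v * schur_factor X v)"
    by (intro prod_schur_factor_expand nz) auto
  also have "(\<Sum>v\<in>set xs. residue_weight (set xs) v * schur_factor X v) =
      (\<Sum>j<length xs. residue_weight (set xs) (xs ! j) * schur_factor X (xs ! j))"
    by (rule sum.reindex_bij_betw[OF bij, symmetric])
  also have "card (set xs) = length xs"
    by (rule distinct_card[OF assms(1)])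
  finally have "schur_prod (X # xs) = of_bool (even (length xs)) * schur_prod xs -
      (\<Sum>j<length xs. (-1) ^ length xs * residue_weight (set xs) (xs ! j) *
         schur_factor X (xs ! j) * schur_prod xs)"
    by (simp add: algebra_simps sum_distrib_left sum_distrib_right)
  also have "(\<Sum>j<length xs. (-1) ^ length xs * residue_weight (set xs) (xs ! j) *
         schur_factor X (xs ! j) * schur_prod xs) =
      (\<Sum>j<length xs. - ((-1) ^ j * schur_factor X (xs ! j) * schur_prod (delete_nth j xs)))"
  proof (intro sum.cong refl)
    fix j assume "j \<in> {..<length xs}"
    then have j: "j < length xs" by simp
    have "schur_prod (delete_nth j xs) =
        (-1) ^ j * (-1) ^ (length xs - 1) * residue_weight (set xs) (xs ! j) * schur_prod xs"
      by (intro schur_prod_delete_nth assms j) auto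
    moreover have "(-1::'a) ^ length xs = - ((-1) ^ (length xs - 1))"
      using j by (cases xs) auto
    moreover have "(-1::'a) ^ j * (-1) ^ j = 1"
      by (simp flip: power_add mult_2)
    moreover have "(- B) * w * s * S = - (A * s * (A * B * w * S))" if "A * A = 1" for A B w s S :: 'a
      using that by algebra
    ultimately show "(-1) ^ length xs * residue_weight (set xs) (xs ! j) *
         schur_factor X (xs ! j) * schur_prod xs =
        - ((-1) ^ j * schur_factor X (xs ! j) * schur_prod (delete_nth j xs))"
      by simp
  qed
  finally show ?thesis
    by (simp add: sum_negf)
qed

text \<open>
  The points may coincide, which matters because the sums below run over all tuples of variables.
  If \<open>y\<close> occurs twice, then the left-hand side is 0; on the right, deleting any other entry leaves
  a repetition, and the two terms that delete one of the two copies of \<open>y\<close> are negatives of each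
  other.
\<close>

lemma schur_pfaffian:
  assumes nz: "\<And>x y. x \<in> set (X # xs) \<Longrightarrow> y \<in> set (X # xs) \<Longrightarrow> x + y \<noteq> 0"
  shows "schur_prod (X # xs) = of_bool (even (length xs)) * schur_prod xs +
    (\<Sum>j<length xs. (-1) ^ j * schur_factor X (xs ! j) * schur_prod (delete_nth j xs))"
proof (cases "distinct xs")
  case True
  then show ?thesis by (rule schur_pfaffian_distinct[OF _ nz])
next
  case False
  then obtain us vs ws y where xs: "xs = us @ y # vs @ y # ws"
    using not_distinct_decomp[OF False] by auto
  let ?p = "length us" and ?q = "length us + Suc (length vs)"
  let ?f = "\<lambda>j. (-1) ^ j * schur_factor X (xs ! j) * schur_prod (delete_nth j xs)"
  \<comment> \<open>Deleting an entry before, between or after the two copies of \<open>y\<close> leaves both copies in place.\<close>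
  have "?f j = 0" if j: "j < length xs" "j \<noteq> ?p" "j \<noteq> ?q" for j
  proof -
    have "\<not> distinct (delete_nth j xs)"
    proof -
      consider "j < ?p" | "?p < j" "j < ?q" | "?q < j"
        using j by linarith
      then show ?thesis
      proof cases
        case 1
        then show ?thesis by (simp add: delete_nth_def xs)
      next
        case 2
        then obtain k where k: "j = ?p + Suc k" "k < length vs"
          by (metis add_less_cancel_left add_Suc_right less_imp_Suc_add not_less_eq Suc_less_eq)
        then show ?thesis by (simp add: delete_nth_def xs)
      next
        case 3
        then obtain k where k: "j = ?q + Suc k"
          by (metis less_imp_Suc_add add_Suc_right)
        then show ?thesis by (simp add: delete_nth_def xs)
      qed
    qed
    then show ?thesis by (simp add: schur_prod_eq_0)
  qed
  then have "sum ?f {..<length xs} = sum ?f {?p, ?q}"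
    by (intro sum.mono_neutral_right) (auto simp: xs)
  also have "\<dots> = ?f ?p + ?f ?q"
    by simp
  also have "\<dots> = 0"
  proof -
    have "delete_nth ?p xs = us @ vs @ y # ws" "xs ! ?p = y"
      by (simp_all add: xs)
    moreover have "delete_nth ?q xs = us @ y # vs @ ws" "xs ! ?q = y"
      using delete_nth_append_Cons[of "us @ y # vs" y ws] by (simp_all add: xs nth_append)
    ultimately show ?thesis
      using schur_prod_move_to_front[of us y "vs @ ws"]
        schur_prod_move_to_front[of "us @ vs" y ws]
      by (simp add: power_add)
  qed
  finally show ?thesis
    using False by (simp add: schur_prod_eq_0)
qed

section \<open>The polynomial expression for Q-functions\<close>

text \<open>
  The power series \<open>(1 + c y) / (1 - c y)\<close>, written out so that it makes sense over any commutative
  ring.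
\<close>

definition gen_factor :: "'a::comm_ring_1 \<Rightarrow> 'a fps" where
  "gen_factor c = Abs_fps (\<lambda>n. if n = 0 then 1 else 2 * c ^ n)"

text \<open>
  The one-row function \<open>q\<^sub>r(z\<^sub>0, \<dots>, z\<^bsub>m-1\<^esub>)\<close>.
\<close>

definition one_row :: "(nat \<Rightarrow> 'a::comm_ring_1) \<Rightarrow> nat \<Rightarrow> nat \<Rightarrow> 'a" where
  "one_row z m r = fps_nth (\<Prod>a<m. gen_factor (z a)) r"

lemma one_row_0 [simp]: "one_row z m 0 = 1"
  unfolding one_row_def by (induction m) (auto simp: gen_factor_def)

lemma one_row_no_variables: "one_row z 0 r = of_bool (r = 0)"
  by (simp add: one_row_def)

lemma one_row_Suc:
  "one_row z (Suc m) r = (\<Sum>i=0..r. one_row z m i * fps_nth (gen_factor (z m)) (r - i))"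
  by (simp add: one_row_def fps_mult_nth)

text \<open>
  The two-row function \<open>Q\<^bsub>(r,s)\<^esub>\<close> in terms of \<open>q\<close>. The usual formula
  \<open>q\<^sub>r q\<^sub>s + 2 (\<Sum>i\<ge>1. (-1) ^ i q\<^bsub>r+i\<^esub> q\<^bsub>s-i\<^esub>)\<close> satisfies the same recursion, which is the shape in
  which both the sums over pairs of variables and the principal specialization appear.
\<close>

primrec two_row :: "(nat \<Rightarrow> 'a::comm_ring_1) \<Rightarrow> nat \<Rightarrow> nat \<Rightarrow> 'a" where
  "two_row q r 0 = q r"
| "two_row q r (Suc s) = q r * q (Suc s) - q (Suc r) * q s - two_row q (Suc r) s"

text \<open>
  The expansion along the first row of the Pfaffian of the matrix of all \<open>two_row q\<close>, bordered by a
  column of \<open>q\<close> in odd size; the term that multiplies \<open>q r\<close> comes from that column. Only ring operations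
  occur, so the expression is compatible with ring homomorphisms and with congruences.
\<close>

function pfaffian_Q :: "(nat \<Rightarrow> 'a::comm_ring_1) \<Rightarrow> nat list \<Rightarrow> 'a" where
  "pfaffian_Q q [] = 1"
| "pfaffian_Q q (r # mu) = of_bool (even (length mu)) * q r * pfaffian_Q q mu +
    (\<Sum>j<length mu. (-1) ^ j * two_row q r (mu ! j) * pfaffian_Q q (delete_nth j mu))"
  by pat_completeness auto
termination
  by (relation "measure (\<lambda>(q, mu). length mu)") auto

locale comm_ring_hom =
  fixes h :: "'a::comm_ring_1 \<Rightarrow> 'b::comm_ring_1"
  assumes hom_add: "h (x + y) = h x + h y"
    and hom_mult: "h (x * y) = h x * h y"
    and hom_1: "h 1 = 1"
begin

lemma hom_0: "h 0 = 0"
  using hom_add[of 0 0] by simp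

lemma hom_uminus: "h (- x) = - h x"
  using hom_add[of x "- x"] by (simp add: hom_0 eq_neg_iff_add_eq_0 add.commute)

lemma hom_diff: "h (x - y) = h x - h y"
  using hom_add[of x "- y"] by (simp add: hom_uminus)

lemma hom_sum: "h (sum f A) = (\<Sum>x\<in>A. h (f x))"
  by (induction A rule: infinite_finite_induct) (auto simp: hom_0 hom_add)

lemma hom_power: "h (x ^ n) = h x ^ n"
  by (induction n) (auto simp: hom_1 hom_mult)

lemma hom_two: "h 2 = 2"
  by (metis hom_1 hom_add one_add_one)

lemma hom_of_bool: "h (of_bool b) = of_bool b"
  by (cases b) (auto simp: hom_0 hom_1)

lemmas hom_simps =
  hom_0 hom_1 hom_add hom_mult hom_uminus hom_diff hom_sum hom_power hom_two hom_of_bool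

lemma hom_one_row: "h (one_row z m r) = one_row (\<lambda>a. h (z a)) m r"
proof (induction m arbitrary: r)
  case 0
  then show ?case by (simp add: one_row_no_variables hom_simps)
next
  case (Suc m)
  have "h (fps_nth (gen_factor c) n) = fps_nth (gen_factor (h c)) n" for c n
    by (simp add: gen_factor_def hom_simps)
  then show ?case
    by (simp add: one_row_Suc Suc hom_simps)
qed

lemma hom_two_row: "h (two_row q r s) = two_row (\<lambda>r. h (q r)) r s"
  by (induction s arbitrary: r) (auto simp: hom_simps)

lemma hom_pfaffian_Q: "h (pfaffian_Q q mu) = pfaffian_Q (\<lambda>r. h (q r)) mu"
proof (induction "\<lambda>r. h (q r)" mu rule: pfaffian_Q.induct)
  case (2 r mu)
  then show ?case by (simp add: hom_simps hom_two_row)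
qed (simp add: hom_simps)

end

lemma dvd_diff_mult_cong:
  fixes d :: "'a::comm_ring_1"
  assumes "d dvd x - x'" "d dvd y - y'"
  shows "d dvd x * y - x' * y'"
proof -
  have "x * y - x' * y' = (x - x') * y + x' * (y - y')"
    by (simp add: algebra_simps)
  then show ?thesis
    using assms by simp
qed

lemma dvd_diff_add_cong:
  fixes d :: "'a::comm_ring_1"
  shows "d dvd x - x' \<Longrightarrow> d dvd y - y' \<Longrightarrow> d dvd (x + y) - (x' + y')"
  by (metis add_diff_add dvd_add)

lemma dvd_diff_diff_cong:
  fixes d :: "'a::comm_ring_1"
  assumes "d dvd x - x'" "d dvd y - y'"
  shows "d dvd (x - y) - (x' - y')"
proof -
  have *: "(x - y) - (x' - y') = (x - x') - (y - y')" by simp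
  show ?thesis unfolding * by (intro dvd_diff assms)
qed

lemma dvd_diff_sum_cong:
  fixes d :: "'a::comm_ring_1"
  assumes "\<And>i. i \<in> I \<Longrightarrow> d dvd f i - g i"
  shows "d dvd sum f I - sum g I"
  using assms by (simp flip: sum_subtractf add: dvd_sum)

text \<open>
  Congruence modulo the ideal generated by \<open>d\<close> serves two purposes: with \<open>d\<close> a variable it controls
  what happens when that variable is adjoined, with \<open>d = t ^ m\<close> it expresses \<open>t\<close>-adic approximation.
\<close>

lemma two_row_cong:
  fixes d :: "'a::comm_ring_1"
  assumes "\<And>r. d dvd q r - q' r"
  shows "d dvd two_row q r s - two_row q' r s"
  by (induction s arbitrary: r)
    (auto intro!: dvd_diff_diff_cong dvd_diff_mult_cong assms)

lemma pfaffian_Q_cong: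
  fixes d :: "'a::comm_ring_1"
  assumes "\<And>r. d dvd q r - q' r"
  shows "d dvd pfaffian_Q q mu - pfaffian_Q q' mu"
  using assms
proof (induction q mu rule: pfaffian_Q.induct)
  case (2 q r mu)
  then show ?case
    unfolding pfaffian_Q.simps
    by (intro dvd_diff_add_cong dvd_diff_sum_cong dvd_diff_mult_cong two_row_cong) auto
qed simp

text \<open>
  A tuple of length \<open>Suc n\<close> is a tuple of length \<open>n\<close> with an entry inserted at position \<open>j\<close>.
\<close>

lemma sum_lists_insert:
  assumes "j \<le> n"
  shows "(\<Sum>fs | set fs \<subseteq> A \<and> length fs = Suc n. f fs) =
    (\<Sum>b\<in>A. \<Sum>gs | set gs \<subseteq> A \<and> length gs = n. f (take j gs @ b # drop j gs))"
proof -
  have "(\<Sum>b\<in>A. \<Sum>gs | set gs \<subseteq> A \<and> length gs = n. f (take j gs @ b # drop j gs)) =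
      (\<Sum>(b, gs)\<in>A \<times> {gs. set gs \<subseteq> A \<and> length gs = n}. f (take j gs @ b # drop j gs))"
    by (rule sum.cartesian_product)
  also have "\<dots> = (\<Sum>fs | set fs \<subseteq> A \<and> length fs = Suc n. f fs)"
  proof (rule sum.reindex_bij_witness[of _ "\<lambda>fs. (fs ! j, delete_nth j fs)"
        "\<lambda>(b, gs). take j gs @ b # drop j gs"], goal_cases)
    case (1 p)
    then show ?case
      using assms by (auto simp: delete_nth_def nth_append min_def)
  next
    case (2 p)
    then show ?case
      using assms by (auto simp: dest: in_set_takeD in_set_dropD)
  next
    case (3 fs)
    then show ?case
      using assms by (auto simp: delete_nth_def min_def id_take_nth_drop[of j fs, symmetric])
  next
    case (4 fs)
    then show ?case
      using assms set_delete_nth[of j fs] nth_mem[of j fs] by auto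
  next
    case (5 p)
    then show ?case by auto
  qed
  finally show ?thesis ..
qed

section \<open>Sums over tuples of variables\<close>

lemma gen_factor_mult: "gen_factor c * (1 - fps_const c * fps_X) = 1 + fps_const c * fps_X"
proof (rule fps_ext)
  fix n
  show "fps_nth (gen_factor c * (1 - fps_const c * fps_X)) n = fps_nth (1 + fps_const c * fps_X) n"
    by (cases n; cases "n - 1")
      (auto simp: gen_factor_def right_diff_distrib mult.left_commute[of _ "fps_const c"])
qed

lemma geometric_fps_mult:
  "Abs_fps (\<lambda>n. c ^ n) * (1 - fps_const c * fps_X) = (1 :: 'a::comm_ring_1 fps)"
proof (rule fps_ext)
  fix n
  show "fps_nth (Abs_fps (\<lambda>n. c ^ n) * (1 - fps_const c * fps_X)) n = fps_nth 1 n"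
    by (cases n)
      (auto simp: right_diff_distrib mult.left_commute[of _ "fps_const c"])
qed

locale generic_variables =
  fixes z :: "nat \<Rightarrow> 'a::field" and m :: nat
  assumes z_inj: "inj_on z {..<m}"
    and z_add_nonzero: "a < m \<Longrightarrow> b < m \<Longrightarrow> z a + z b \<noteq> 0"
begin

definition weight :: "nat \<Rightarrow> 'a" where
  "weight a = residue_weight (z ` {..<m}) (z a)"

lemma weight_eq: "a < m \<Longrightarrow> weight a = (\<Prod>b\<in>{..<m} - {a}. (z a + z b) / (z a - z b))"
proof -
  assume a: "a < m"
  have "z ` {..<m} - {z a} = z ` ({..<m} - {a})"
    using z_inj a by (auto simp: inj_on_def)
  then show ?thesis
    unfolding weight_def residue_weight_def
    by (simp add: prod.reindex inj_on_subset[OF z_inj])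
qed

lemma image_add_nonzero: "u \<in> z ` {..<m} \<Longrightarrow> v \<in> z ` {..<m} \<Longrightarrow> u + v \<noteq> 0"
  using z_add_nonzero by auto

lemma card_image_z: "card (z ` {..<m}) = m"
  using card_image[OF z_inj] by simp

text \<open>
  The partial fraction decomposition of the generating function of the one-row functions.
\<close>

lemma one_row_fps:
  "(\<Prod>a<m. gen_factor (z a)) =
    fps_const ((-1) ^ m) + (\<Sum>a<m. fps_const (2 * weight a) * Abs_fps (\<lambda>n. z a ^ n))"
    (is "?F = ?G")
proof -
  \<comment> \<open>Multiplying by the nonzero series \<open>?D\<close> turns the claim into the identity of polynomials.\<close>
  let ?D = "\<Prod>a<m. 1 - fps_const (z a) * fps_X"
  have "fps_nth ?D 0 = 1"
    by (induction m) auto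
  then have D: "?D \<noteq> 0"
    by auto
  have lin: "fps_of_poly [:1, c:] = 1 + fps_const c * fps_X" for c :: 'a
    by (simp add: fps_of_poly_pCons)
  have "?F * ?D = (\<Prod>a<m. 1 + fps_const (z a) * fps_X)"
    unfolding prod.distrib[symmetric] by (simp add: gen_factor_mult)
  also have "\<dots> = fps_of_poly (\<Prod>a<m. [:1, z a:])"
    by (simp add: fps_of_poly_prod lin)
  also have "(\<Prod>a<m. [:1, z a:]) = smult ((-1) ^ m) (\<Prod>a<m. [:1, - z a:]) +
      (\<Sum>a<m. smult (2 * weight a) (\<Prod>b\<in>{..<m} - {a}. [:1, - z b:]))"
  proof -
    have "z ` {..<m} - {z a} = z ` ({..<m} - {a})" if "a < m" for a
      using z_inj that by (auto simp: inj_on_def)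
    then show ?thesis
      using partial_fractions_poly[of "z ` {..<m}", OF _ image_add_nonzero]
      by (simp add: prod.reindex[OF z_inj] sum.reindex[OF z_inj] card_image_z weight_def
          prod.reindex[OF inj_on_subset[OF z_inj]])
  qed
  also have "fps_of_poly \<dots> = fps_const ((-1) ^ m) * ?D +
      (\<Sum>a<m. fps_const (2 * weight a) * (\<Prod>b\<in>{..<m} - {a}. 1 - fps_const (z b) * fps_X))"
    by (simp add: fps_of_poly_add fps_of_poly_smult fps_of_poly_sum fps_of_poly_prod lin
        del: fps_const_mult fps_const_power flip: fps_const_neg)
  also have "(\<Sum>a<m. fps_const (2 * weight a) * (\<Prod>b\<in>{..<m} - {a}. 1 - fps_const (z b) * fps_X)) =
      (\<Sum>a<m. fps_const (2 * weight a) * Abs_fps (\<lambda>n. z a ^ n)) * ?D"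
    unfolding sum_distrib_right
  proof (intro sum.cong refl)
    fix a assume "a \<in> {..<m}"
    then have "?D = (1 - fps_const (z a) * fps_X) * (\<Prod>b\<in>{..<m} - {a}. 1 - fps_const (z b) * fps_X)"
      by (intro prod.remove) auto
    then have "Abs_fps (\<lambda>n. z a ^ n) * ?D =
        (Abs_fps (\<lambda>n. z a ^ n) * (1 - fps_const (z a) * fps_X)) *
        (\<Prod>b\<in>{..<m} - {a}. 1 - fps_const (z b) * fps_X)"
      by (simp only: mult.assoc)
    then show "fps_const (2 * weight a) * (\<Prod>b\<in>{..<m} - {a}. 1 - fps_const (z b) * fps_X) =
        fps_const (2 * weight a) * Abs_fps (\<lambda>n. z a ^ n) * ?D"
      by (simp only: geometric_fps_mult mult.assoc mult_1_left)
  qed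
  finally have "?F * ?D = ?G * ?D"
    by (simp only: distrib_right)
  then show ?thesis
    using D by simp
qed

text \<open>
  The constant term is an exception: \<open>one_row z m 0 = 1\<close>, but the sum on the right is then 0 or 2
  according to the parity of \<open>m\<close>, by the next lemma.
\<close>

lemma one_row_eq:
  assumes "r \<ge> 1"
  shows "one_row z m r = (\<Sum>a<m. 2 * weight a * z a ^ r)"
  using assms by (simp add: one_row_def one_row_fps fps_sum_nth)

lemma sum_weight: "(\<Sum>a<m. 2 * weight a) = 1 - (-1) ^ m"
  using arg_cong[OF one_row_fps, of "\<lambda>f. fps_nth f 0"] one_row_0[of z m]
  by (simp add: one_row_def fps_sum_nth algebra_simps)

definition row_weight :: "nat \<Rightarrow> nat \<Rightarrow> 'a" where
  "row_weight r a = 2 * weight a * z a ^ r"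

text \<open>
  The sum over tuples that corresponds to two rows.
\<close>

definition pair_sum :: "nat \<Rightarrow> nat \<Rightarrow> 'a" where
  "pair_sum r s = (\<Sum>a<m. \<Sum>b<m. row_weight r a * row_weight s b * schur_factor (z a) (z b))"

text \<open>
  The inner sum is evaluated by the partial fraction expansion of
  \<open>\<Prod>b<m. schur_factor X (z b)\<close> at \<open>X = z a\<close>, where this product vanishes.
\<close>

lemma pair_sum_0: 
  "pair_sum r 0 = (1 + (-1) ^ m) * (\<Sum>a<m. row_weight r a)"
proof -
  have "(\<Sum>b<m. row_weight 0 b * schur_factor (z a) (z b)) = 1 + (-1) ^ m" if a: "a < m" for a
  proof -
    have za: "z a \<noteq> 0"
      using z_add_nonzero[OF a a] by auto
    have "(\<Prod>v\<in>z ` {..<m}. schur_factor (z a) v) = 0"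
      using a by (auto simp: prod.reindex[OF z_inj] intro!: prod_zero bexI[of _ a])
    then have "0 = 1 + (-1) ^ m * (\<Sum>b<m. 2 * weight b * (z a / (z a + z b)))"
      using partial_fractions[of "z ` {..<m}" "z a", OF _ image_add_nonzero za image_add_nonzero] a
      by (simp add: sum.reindex[OF z_inj] card_image_z weight_def)
    then have *: "(\<Sum>b<m. 2 * weight b * (z a / (z a + z b))) = - ((-1) ^ m)"
      by (cases "even m") (auto simp: eq_neg_iff_add_eq_0 add.commute)
    have "row_weight 0 b * schur_factor (z a) (z b) =
        2 * weight b - 2 * (2 * weight b * (z a / (z a + z b)))" if "b < m" for b
      using z_add_nonzero[OF a that] by (simp add: row_weight_def schur_factor_def field_simps)
    then have "(\<Sum>b<m. row_weight 0 b * schur_factor (z a) (z b)) =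
        (\<Sum>b<m. 2 * weight b) - 2 * (\<Sum>b<m. 2 * weight b * (z a / (z a + z b)))"
      by (simp add: sum_subtractf sum_distrib_left)
    then show ?thesis
      unfolding * sum_weight by simp
  qed
  moreover have "pair_sum r 0 =
      (\<Sum>a<m. row_weight r a * (\<Sum>b<m. row_weight 0 b * schur_factor (z a) (z b)))"
    by (simp add: pair_sum_def sum_distrib_left mult.assoc)
  ultimately show ?thesis
    by (simp add: sum_distrib_left mult.commute)
qed

text \<open>
  Raising one of the two exponents by one multiplies a term by \<open>z a\<close> or by \<open>z b\<close>, and in the sum of
  both cases the factor \<open>z a + z b\<close> cancels the denominator of \<open>schur_factor\<close>; so the double sum splits.
\<close>

lemma pair_sum_Suc:
  "pair_sum (Suc r) s + pair_sum r (Suc s) =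
    (\<Sum>a<m. row_weight r a) * (\<Sum>b<m. row_weight (Suc s) b) -
    (\<Sum>a<m. row_weight (Suc r) a) * (\<Sum>b<m. row_weight s b)"
proof -
  have "row_weight (Suc r) a * row_weight s b * schur_factor (z a) (z b) +
      row_weight r a * row_weight (Suc s) b * schur_factor (z a) (z b) =
      row_weight r a * row_weight (Suc s) b - row_weight (Suc r) a * row_weight s b"
    if "a < m" "b < m" for a b
  proof -
    have "(z a + z b) * schur_factor (z a) (z b) = z b - z a"
      using z_add_nonzero[OF that] by (simp add: schur_factor_def)
    moreover have "row_weight (Suc r) a = row_weight r a * z a"
      "row_weight (Suc s) b = row_weight s b * z b"
      by (simp_all add: row_weight_def)
    ultimately show ?thesis by algebra
  qed
  then show ?thesis
    unfolding pair_sum_def sum_product sum.distrib[symmetric] sum_subtractf[symmetric]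
    by (intro sum.cong refl) auto
qed

lemma row_sum: "r \<ge> 1 \<Longrightarrow> (\<Sum>a<m. row_weight r a) = one_row z m r"
  by (simp add: row_weight_def one_row_eq)

text \<open>
  The exponent \<open>0\<close> is excluded on the left-hand side because \<open>pair_sum r 0\<close> depends on the parity of
  \<open>m\<close>, whereas \<open>two_row q r 0 = q r\<close>. At \<open>s = 1\<close> the parities of \<open>pair_sum (Suc r) 0\<close> and of the total
  weight cancel, so that the two recursions agree from there on.
\<close>

lemma pair_sum_eq_two_row:
  assumes "r \<ge> 1"
  shows "pair_sum r (Suc s) = two_row (one_row z m) r (Suc s)"
  using assms
proof (induction s arbitrary: r)
  case 0
  have zero: "(\<Sum>a<m. row_weight 0 a) = 1 - (-1) ^ m"
    using sum_weight by (simp add: row_weight_def)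
  have "pair_sum r (Suc 0) =
      one_row z m r * one_row z m 1 - one_row z m (Suc r) * (1 - (-1) ^ m) - pair_sum (Suc r) 0"
    using pair_sum_Suc[of r 0] 0 zero by (simp add: row_sum eq_diff_eq add.commute)
  then show ?case
    using 0 by (simp add: pair_sum_0 row_sum algebra_simps)
next
  case (Suc s)
  then have "pair_sum (Suc r) (Suc s) = two_row (one_row z m) (Suc r) (Suc s)"
    by simp
  moreover have "pair_sum (Suc r) (Suc s) + pair_sum r (Suc (Suc s)) =
      one_row z m r * one_row z m (Suc (Suc s)) - one_row z m (Suc r) * one_row z m (Suc s)"
    using pair_sum_Suc[of r "Suc s"] Suc.prems by (simp add: row_sum)
  ultimately show ?case
    by (metis add_diff_cancel_left' two_row.simps(2))
qed

definition tuple_weight :: "nat list \<Rightarrow> nat list \<Rightarrow> 'a" where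
  "tuple_weight lam fs = (\<Prod>(r, a)\<leftarrow>zip lam fs. row_weight r a)"

text \<open>
  The sum that defines the Q-function, extended to all tuples: those with a repeated entry
  contribute 0, since \<open>schur_prod\<close> vanishes on them. In the sum over all tuples each entry runs over
  all variables independently of the others, which makes it possible to split off single entries.
\<close>

definition tuple_sum :: "nat list \<Rightarrow> 'a" where
  "tuple_sum lam = (\<Sum>fs | set fs \<subseteq> {..<m} \<and> length fs = length lam.
     tuple_weight lam fs * schur_prod (map z fs))"

lemma tuple_weight_insert:
  assumes "j < length mu" "length gs = length mu - 1"
  shows "tuple_weight mu (take j gs @ b # drop j gs) =
    row_weight (mu ! j) b * tuple_weight (delete_nth j mu) gs"
proof -
  have "zip mu (take j gs @ b # drop j gs) =
      zip (take j mu) (take j gs) @ (mu ! j, b) # zip (drop (Suc j) mu) (drop j gs)"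
    using assms by (subst id_take_nth_drop[of j mu]) (auto simp: zip_append)
  moreover have "zip (delete_nth j mu) gs =
      zip (take j mu) (take j gs) @ zip (drop (Suc j) mu) (drop j gs)"
  proof -
    have "zip (delete_nth j mu) (take j gs @ drop j gs) =
      zip (take j mu) (take j gs) @ zip (drop (Suc j) mu) (drop j gs)"
      using assms unfolding delete_nth_def by (subst zip_append) auto
    then show ?thesis by simp
  qed
  ultimately show ?thesis
    by (simp add: tuple_weight_def mult_ac)
qed

text \<open>
  Schur's expansion in every term. In the summand of \<open>j\<close> the entry at position \<open>j\<close> is coupled only
  to the first entry, so the sum over these two entries separates from the sum over the others.
\<close>

lemma tuple_sum_Cons:
  "tuple_sum (r # mu) = of_bool (even (length mu)) * (\<Sum>a<m. row_weight r a) * tuple_sum mu +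
    (\<Sum>j<length mu. (-1) ^ j * pair_sum r (mu ! j) * tuple_sum (delete_nth j mu))"
proof -
  let ?n = "length mu"
  let ?L = "\<lambda>n. {fs. set fs \<subseteq> {..<m} \<and> length fs = n}"
  let ?w = "\<lambda>a fs. row_weight r a * tuple_weight mu fs"
  let ?t = "\<lambda>a fs j. schur_factor (z a) (z (fs ! j)) * schur_prod (delete_nth j (map z fs))"
  have "tuple_sum (r # mu) = (\<Sum>a<m. \<Sum>fs\<in>?L ?n. ?w a fs * schur_prod (map z (a # fs)))"
    using sum_lists_insert[of 0 ?n "\<lambda>fs. tuple_weight (r # mu) fs * schur_prod (map z fs)" "{..<m}"]
    by (simp add: tuple_sum_def tuple_weight_def)
  also have "\<dots> = (\<Sum>a<m. \<Sum>fs\<in>?L ?n. of_bool (even ?n) * (?w a fs * schur_prod (map z fs)) +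
      (\<Sum>j<?n. (-1) ^ j * (?w a fs * ?t a fs j)))"
  proof (intro sum.cong refl)
    fix a fs assume a: "a \<in> {..<m}" and fs: "fs \<in> ?L ?n"
    have "schur_prod (map z (a # fs)) = of_bool (even (length (map z fs))) * schur_prod (map z fs) +
      (\<Sum>j<length (map z fs). (-1) ^ j * schur_factor (z a) (map z fs ! j) *
         schur_prod (delete_nth j (map z fs)))"
      unfolding list.map using a fs by (intro schur_pfaffian image_add_nonzero) auto
    then show "?w a fs * schur_prod (map z (a # fs)) =
        of_bool (even ?n) * (?w a fs * schur_prod (map z fs)) + (\<Sum>j<?n. (-1) ^ j * (?w a fs * ?t a fs j))"
      using fs by (simp add: distrib_left sum_distrib_left mult_ac)
  qed
  also have "\<dots> = of_bool (even ?n) * (\<Sum>a<m. \<Sum>fs\<in>?L ?n. ?w a fs * schur_prod (map z fs)) +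
      (\<Sum>j<?n. (-1) ^ j * (\<Sum>a<m. \<Sum>fs\<in>?L ?n. ?w a fs * ?t a fs j))"
    unfolding sum.distrib sum_distrib_left
    by (simp only: sum.swap[of _ "{..<?n}"])
  also have "(\<Sum>a<m. \<Sum>fs\<in>?L ?n. ?w a fs * schur_prod (map z fs)) =
      (\<Sum>a<m. row_weight r a) * tuple_sum mu"
    unfolding tuple_sum_def sum_product by (simp add: mult.assoc)
  also have "(\<Sum>j<?n. (-1) ^ j * (\<Sum>a<m. \<Sum>fs\<in>?L ?n. ?w a fs * ?t a fs j)) =
      (\<Sum>j<?n. (-1) ^ j * (pair_sum r (mu ! j) * tuple_sum (delete_nth j mu)))"
  proof (intro sum.cong refl arg_cong2[where f = "(*)"])
    fix j assume "j \<in> {..<?n}"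
    then have j: "j < ?n" by simp
    then obtain n' where n': "?n = Suc n'" by (cases ?n) auto
    have "(\<Sum>fs\<in>?L ?n. ?w a fs * ?t a fs j) =
        (\<Sum>b<m. row_weight r a * row_weight (mu ! j) b * schur_factor (z a) (z b)) *
        tuple_sum (delete_nth j mu)" for a
    proof -
      have "(\<Sum>fs\<in>?L ?n. ?w a fs * ?t a fs j) =
          (\<Sum>b<m. \<Sum>gs\<in>?L n'. ?w a (take j gs @ b # drop j gs) * ?t a (take j gs @ b # drop j gs) j)"
        unfolding n' by (rule sum_lists_insert) (use j n' in simp)
      also have "\<dots> = (\<Sum>b<m. \<Sum>gs\<in>?L n'.
          (row_weight r a * row_weight (mu ! j) b * schur_factor (z a) (z b)) *
          (tuple_weight (delete_nth j mu) gs * schur_prod (map z gs)))"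
      proof (intro sum.cong refl)
        fix b gs assume gs: "gs \<in> ?L n'"
        have len: "length (take j gs) = j"
          using gs j n' by simp
        have "delete_nth j (take j gs @ b # drop j gs) = gs" "(take j gs @ b # drop j gs) ! j = b"
          using delete_nth_append_Cons[of "take j gs" b "drop j gs"]
            nth_append_length[of "take j gs" b "drop j gs"] unfolding len by simp_all
        moreover have "tuple_weight mu (take j gs @ b # drop j gs) =
            row_weight (mu ! j) b * tuple_weight (delete_nth j mu) gs"
          using gs n' by (intro tuple_weight_insert j) simp
        ultimately show "?w a (take j gs @ b # drop j gs) * ?t a (take j gs @ b # drop j gs) j =
          (row_weight r a * row_weight (mu ! j) b * schur_factor (z a) (z b)) *
          (tuple_weight (delete_nth j mu) gs * schur_prod (map z gs))"
          by (simp only: map_delete_nth[symmetric] mult_ac)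
      qed
      also have "\<dots> = (\<Sum>b<m. row_weight r a * row_weight (mu ! j) b * schur_factor (z a) (z b)) *
          tuple_sum (delete_nth j mu)"
        unfolding tuple_sum_def sum_product using j n' by simp
      finally show ?thesis .
    qed
    then show "(\<Sum>a<m. \<Sum>fs\<in>?L ?n. ?w a fs * ?t a fs j) =
        pair_sum r (mu ! j) * tuple_sum (delete_nth j mu)"
      by (simp add: pair_sum_def sum_distrib_right)
  qed
  finally show ?thesis
    by (simp add: mult.assoc)
qed

lemma tuple_sum_eq_pfaffian:
  assumes "\<And>r. r \<in> set lam \<Longrightarrow> r \<ge> 1"
  shows "tuple_sum lam = pfaffian_Q (one_row z m) lam"
  using assms
proof (induction "one_row z m" lam rule: pfaffian_Q.induct)
  case 1
  have "{fs. set fs \<subseteq> {..<m} \<and> length fs = length ([] :: nat list)} = {[]}"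
    by auto
  then show ?case
    by (simp add: tuple_sum_def tuple_weight_def)
next
  case (2 r mu)
  have "pair_sum r (mu ! j) = two_row (one_row z m) r (mu ! j)" if "j < length mu" for j
  proof -
    have "mu ! j \<ge> 1"
      using that by (intro 2(3)) simp
    then show ?thesis
      using 2(3)[of r] by (cases "mu ! j") (simp_all add: pair_sum_eq_two_row del: two_row.simps)
  qed
  moreover have "tuple_sum (delete_nth j mu) = pfaffian_Q (one_row z m) (delete_nth j mu)"
    if "j < length mu" for j
    using that 2(3) set_delete_nth[of j mu] by (intro 2(2)) auto
  ultimately show ?case
    using 2 by (simp add: tuple_sum_Cons row_sum)
qed

end

section \<open>From cosets of permutations to tuples\<close>

lemma schur_prod_nth:
  "schur_prod xs = (\<Prod>i<length xs. \<Prod>k<i. schur_factor (xs ! k) (xs ! i))"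
proof -
  have append1: "schur_prod (xs @ [y]) = schur_prod xs * (\<Prod>x\<leftarrow>xs. schur_factor x y)" for xs and y :: 'a
    by (induction xs) (simp_all add: mult_ac)
  show ?thesis
  proof (induction xs rule: rev_induct)
    case (snoc y xs)
    have "(\<Prod>i<length xs. \<Prod>k<i. schur_factor ((xs @ [y]) ! k) ((xs @ [y]) ! i)) = schur_prod xs"
      unfolding snoc.IH by (intro prod.cong) (auto simp: nth_append)
    moreover have "(\<Prod>k<length xs. schur_factor ((xs @ [y]) ! k) y) = (\<Prod>x\<leftarrow>xs. schur_factor x y)"
      by (subst prod.list_conv_set_nth) (auto simp: nth_append atLeast0LessThan intro!: prod.cong)
    ultimately show ?case
      by (simp add: append1)
  qed simp
qed

context generic_variables
begin

text \<open>
  The weight of the entry \<open>a\<close> at position \<open>i\<close> contains the factor \<open>(z a + z b) / (z a - z b)\<close> for every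
  \<open>b\<close>, also for the earlier entries; the factors of \<open>schur_prod\<close> cancel exactly the latter.
\<close>

lemma tuple_weight_schur_prod:
  assumes len: "length fs = length lam" and dist: "distinct fs" and sub: "set fs \<subseteq> {..<m}"
  shows "tuple_weight lam fs * schur_prod (map z fs) =
    2 ^ length lam * ((\<Prod>i<length lam. z (fs ! i) ^ (lam ! i)) *
    (\<Prod>i<length lam. \<Prod>b\<in>{..<m} - set (take (Suc i) fs).
       (z (fs ! i) + z b) / (z (fs ! i) - z b)))"
proof -
  have "weight (fs ! i) * (\<Prod>k<i. schur_factor (z (fs ! k)) (z (fs ! i))) =
      (\<Prod>b\<in>{..<m} - set (take (Suc i) fs). (z (fs ! i) + z b) / (z (fs ! i) - z b))"
    if i: "i < length lam" for i
  proof -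
    define a where "a = fs ! i"
    let ?T = "set (take i fs)"
    let ?f = "\<lambda>b. (z a + z b) / (z a - z b)"
    have am: "a < m"
      using sub i len unfolding a_def by (metis lessThan_iff nth_mem subsetD)
    have take_insert: "set (take (Suc i) fs) = insert a ?T"
      using i len by (simp add: take_Suc_conv_app_nth a_def)
    have aT: "a \<notin> ?T"
      using dist i len distinct_take[of fs "Suc i"] by (simp add: take_Suc_conv_app_nth a_def)
    have Tm: "?T \<subseteq> {..<m}"
      using sub by (auto dest: in_set_takeD)
    have inj: "inj_on ((!) fs) {..<i}"
      using dist i len by (auto simp: inj_on_def nth_eq_iff_index_eq)
    have img: "?T = (!) fs ` {..<i}"
      using nth_image[of i fs] i len by (simp add: atLeast0LessThan)
    have "weight a = (\<Prod>b\<in>{..<m} - insert a ?T. ?f b) * (\<Prod>b\<in>?T. ?f b)"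
    proof -
      have split: "{..<m} - {a} = ({..<m} - insert a ?T) \<union> ?T"
        using aT Tm by auto
      show ?thesis
        unfolding weight_eq[OF am] split by (rule prod.union_disjoint) auto
    qed
    moreover have "(\<Prod>b\<in>?T. ?f b) * (\<Prod>k<i. schur_factor (z (fs ! k)) (z a)) = 1"
    proof -
      have "(\<Prod>k<i. schur_factor (z (fs ! k)) (z a)) = (\<Prod>b\<in>?T. schur_factor (z b) (z a))"
        unfolding img by (simp add: prod.reindex[OF inj])
      then have "(\<Prod>b\<in>?T. ?f b) * (\<Prod>k<i. schur_factor (z (fs ! k)) (z a)) =
          (\<Prod>b\<in>?T. ?f b * schur_factor (z b) (z a))"
        by (simp only: prod.distrib)
      also have "\<dots> = (\<Prod>b\<in>?T. 1)"
      proof (intro prod.cong refl)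
        fix b assume b: "b \<in> ?T"
        then have "z a - z b \<noteq> 0" "z a + z b \<noteq> 0"
          using aT Tm am z_inj z_add_nonzero[of a b] by (auto simp: inj_on_def subset_iff)
        then show "?f b * schur_factor (z b) (z a) = 1"
          by (simp add: schur_factor_def add.commute)
      qed
      finally show ?thesis by simp
    qed
    ultimately show ?thesis
      unfolding take_insert a_def[symmetric] by (simp add: mult.assoc)
  qed
  then have split: "(\<Prod>i<length lam. weight (fs ! i)) *
      (\<Prod>i<length lam. \<Prod>k<i. schur_factor (z (fs ! k)) (z (fs ! i))) =
      (\<Prod>i<length lam. \<Prod>b\<in>{..<m} - set (take (Suc i) fs). (z (fs ! i) + z b) / (z (fs ! i) - z b))"
    unfolding prod.distrib[symmetric] by (intro prod.cong) auto
  have S: "schur_prod (map z fs) =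
      (\<Prod>i<length lam. \<Prod>k<i. schur_factor (z (fs ! k)) (z (fs ! i)))"
    unfolding schur_prod_nth using len by (intro prod.cong) auto
  have "tuple_weight lam fs = (\<Prod>i<length lam. row_weight (lam ! i) (fs ! i))"
    using len by (simp add: tuple_weight_def prod.list_conv_set_nth atLeast0LessThan)
  also have "\<dots> = 2 ^ length lam * ((\<Prod>i<length lam. z (fs ! i) ^ (lam ! i)) *
      (\<Prod>i<length lam. weight (fs ! i)))"
    unfolding row_weight_def prod.distrib by simp
  finally show ?thesis
    unfolding S by (simp only: mult.assoc split)
qed

lemma sum_distinct_tuples:
  "(\<Sum>fs | distinct fs \<and> set fs \<subseteq> {..<m} \<and> length fs = length lam.
      2 ^ length lam * ((\<Prod>i<length lam. z (fs ! i) ^ (lam ! i)) *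
      (\<Prod>i<length lam. \<Prod>b\<in>{..<m} - set (take (Suc i) fs).
         (z (fs ! i) + z b) / (z (fs ! i) - z b)))) = tuple_sum lam"
proof -
  have "tuple_sum lam = (\<Sum>fs | distinct fs \<and> set fs \<subseteq> {..<m} \<and> length fs = length lam.
      tuple_weight lam fs * schur_prod (map z fs))"
    unfolding tuple_sum_def
  proof (rule sum.mono_neutral_right)
    show "finite {fs. set fs \<subseteq> {..<m} \<and> length fs = length lam}"
      by (rule finite_lists_length_eq) simp
    show "\<forall>fs\<in>{fs. set fs \<subseteq> {..<m} \<and> length fs = length lam} -
        {fs. distinct fs \<and> set fs \<subseteq> {..<m} \<and> length fs = length lam}.
        tuple_weight lam fs * schur_prod (map z fs) = 0"
    proof
      fix fs assume "fs \<in> {fs. set fs \<subseteq> {..<m} \<and> length fs = length lam} -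
        {fs. distinct fs \<and> set fs \<subseteq> {..<m} \<and> length fs = length lam}"
      then have "\<not> distinct (map z fs)"
        by (auto simp: distinct_map)
      then show "tuple_weight lam fs * schur_prod (map z fs) = 0"
        by (simp add: schur_prod_eq_0)
    qed
  qed auto
  also have "\<dots> = (\<Sum>fs | distinct fs \<and> set fs \<subseteq> {..<m} \<and> length fs = length lam.
      2 ^ length lam * ((\<Prod>i<length lam. z (fs ! i) ^ (lam ! i)) *
      (\<Prod>i<length lam. \<Prod>b\<in>{..<m} - set (take (Suc i) fs).
         (z (fs ! i) + z b) / (z (fs ! i) - z b))))"
    by (intro sum.cong refl tuple_weight_schur_prod) auto
  finally show ?thesis ..
qed

end

lemma permutation_extending_list:
  assumes "distinct fs" "set fs \<subseteq> {..<m}"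
  obtains w where "w permutes {..<m}" "map w [0..<length fs] = fs"
proof -
  obtain gs where gs: "set gs = {..<m} - set fs" "distinct gs"
    using finite_distinct_list[of "{..<m} - set fs"] by auto
  define hs where "hs = fs @ gs"
  have hs: "distinct hs" "set hs = {..<m}"
    using assms gs by (auto simp: hs_def)
  then have len: "length hs = m"
    using distinct_card[of hs] by simp
  define w where "w i = (if i < m then hs ! i else i)" for i
  have "bij_betw ((!) hs) {..<m} {..<m}"
    by (rule bij_betw_nth[OF hs(1)]) (simp_all add: len hs(2))
  then have "bij_betw w {..<m} {..<m}"
    by (subst bij_betw_cong[of _ w "(!) hs"]) (auto simp: w_def)
  then have "w permutes {..<m}"
    by (rule bij_imp_permutes) (simp add: w_def)
  moreover have "map w [0..<length fs] = fs"
    using len by (intro nth_equalityI) (auto simp: w_def hs_def nth_append)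
  ultimately show ?thesis
    using that by blast
qed

text \<open>
  A left coset of the permutations of \<open>{l..<m}\<close> is determined by the common values of its elements
  on \<open>{..<l}\<close>.
\<close>

lemma sum_sym_cosets:
  fixes F :: "nat list \<Rightarrow> 'a::comm_monoid_add"
  assumes "l \<le> m"
  shows "(\<Sum>C\<in>sym_cosets m l. F (map (SOME w. w \<in> C) [0..<l])) =
    (\<Sum>fs | distinct fs \<and> set fs \<subseteq> {..<m} \<and> length fs = l. F fs)"
proof -
  define coset where "coset w = (\<lambda>v. w \<circ> v) ` {v. v permutes {l..<m}}" for w :: "nat \<Rightarrow> nat"
  have self: "w \<in> coset w" for w
    unfolding coset_def by (rule image_eqI[of _ _ id]) (auto simp: permutes_id)
  have key: "map (SOME w'. w' \<in> coset w) [0..<l] = map w [0..<l]" for w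
  proof -
    have "(SOME w'. w' \<in> coset w) \<in> coset w"
      by (rule someI[of "\<lambda>w'. w' \<in> coset w", OF self])
    then obtain v where "v permutes {l..<m}" "(SOME w'. w' \<in> coset w) = w \<circ> v"
      by (auto simp: coset_def)
    then show ?thesis
      by (auto simp: permutes_not_in)
  qed
  \<comment> \<open>If \<open>w1\<close> and \<open>w2\<close> agree on \<open>{..<l}\<close>, then \<open>inv w2 \<circ> w1\<close> fixes \<open>{..<l}\<close> pointwise.\<close>
  have coset_le: "coset w1 \<subseteq> coset w2"
    if w: "w1 permutes {..<m}" "w2 permutes {..<m}" and eq: "map w1 [0..<l] = map w2 [0..<l]" for w1 w2
  proof
    fix w assume "w \<in> coset w1"
    then obtain v where v: "v permutes {l..<m}" "w = w1 \<circ> v"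
      by (auto simp: coset_def)
    define u where "u = inv w2 \<circ> w1"
    have "u permutes {..<m}"
      unfolding u_def using w by (intro permutes_compose permutes_inv)
    moreover have "u i = i" if "i \<in> {..<m} - {l..<m}" for i
      using eq that w(2) by (auto simp: u_def permutes_inverses)
    ultimately have "u permutes {l..<m}"
      by (rule permutes_superset)
    then have "u \<circ> v permutes {l..<m}"
      using v(1) by (intro permutes_compose)
    moreover have "w = w2 \<circ> (u \<circ> v)"
      using w(2) v(2) by (auto simp: u_def fun_eq_iff permutes_inverses)
    ultimately show "w \<in> coset w2"
      by (auto simp: coset_def)
  qed
  have S: "sym_cosets m l = coset ` {w. w permutes {..<m}}"
    by (simp add: sym_cosets_def coset_def)
  have "bij_betw (\<lambda>C. map (SOME w. w \<in> C) [0..<l]) (sym_cosets m l)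
      {fs. distinct fs \<and> set fs \<subseteq> {..<m} \<and> length fs = l}"
  proof (rule bij_betw_imageI)
    show "inj_on (\<lambda>C. map (SOME w. w \<in> C) [0..<l]) (sym_cosets m l)"
    proof (rule inj_onI)
      fix C D assume "C \<in> sym_cosets m l" "D \<in> sym_cosets m l"
        and eq: "map (SOME w. w \<in> C) [0..<l] = map (SOME w. w \<in> D) [0..<l]"
      then obtain w1 w2 where w: "w1 permutes {..<m}" "C = coset w1" "w2 permutes {..<m}" "D = coset w2"
        unfolding S by blast
      then show "C = D"
        using eq coset_le[of w1 w2] coset_le[of w2 w1] unfolding w(2,4) key by simp
    qed
    show "(\<lambda>C. map (SOME w. w \<in> C) [0..<l]) ` sym_cosets m l =
        {fs. distinct fs \<and> set fs \<subseteq> {..<m} \<and> length fs = l}"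
    proof (intro equalityI subsetI)
      fix fs assume "fs \<in> (\<lambda>C. map (SOME w. w \<in> C) [0..<l]) ` sym_cosets m l"
      then obtain w where w: "w permutes {..<m}" "fs = map w [0..<l]"
        unfolding S image_image key by blast
      have "inj_on w {0..<l}"
        using permutes_inj[OF w(1)] by (rule inj_on_subset) simp
      moreover have "w i < m" if "i < l" for i
        using permutes_in_image[OF w(1), of i] that assms by simp
      ultimately show "fs \<in> {fs. distinct fs \<and> set fs \<subseteq> {..<m} \<and> length fs = l}"
        unfolding w(2) by (simp add: distinct_map image_subset_iff)
    next
      fix fs assume "fs \<in> {fs. distinct fs \<and> set fs \<subseteq> {..<m} \<and> length fs = l}"
      then obtain w where "w permutes {..<m}" "map w [0..<l] = fs"
        using permutation_extending_list[of fs m] by auto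
      then show "fs \<in> (\<lambda>C. map (SOME w. w \<in> C) [0..<l]) ` sym_cosets m l"
        unfolding S image_image key by blast
    qed
  qed
  then show ?thesis
    by (rule sum.reindex_bij_betw)
qed

section \<open>The Schur Q-function and its specialization through the Pfaffian\<close>

interpretation to_fract_hom: comm_ring_hom "to_fract :: 'a::idom \<Rightarrow> 'a fract"
  by unfold_locales simp_all

lemma variable_inj: "variable a = variable b \<longleftrightarrow> a = b"
  unfolding variable_def by (metis inj_single injD lookup_single_eq lookup_single_not_eq one_neq_zero)

lemma variable_add_nonzero: "variable a + variable b \<noteq> 0"
proof
  assume "variable a + variable b = 0"
  then have "Poly_Mapping.lookup (variable a + variable b) (Poly_Mapping.single a 1) = 0"
    by simp
  moreover have "Poly_Mapping.lookup (variable b) (Poly_Mapping.single a 1) \<ge> 0"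
    by (simp add: variable_def lookup_single when_def)
  ultimately show False
    by (simp add: lookup_add variable_def)
qed

interpretation z_var: generic_variables z_var m for m
proof
  show "inj_on z_var {..<m}"
    by (simp add: inj_on_def z_var_def variable_inj)
  show "z_var a + z_var b \<noteq> 0" for a b
    unfolding z_var_def to_fract_add[symmetric] to_fract_eq_0_iff by (rule variable_add_nonzero)
qed

text \<open>
  In particular the rational function is a polynomial, as the Pfaffian expression can be formed
  in the ring of polynomials.
\<close>

lemma schurQ_fract_eq_pfaffian:
  assumes "length lam \<le> m" "\<And>r. r \<in> set lam \<Longrightarrow> r \<ge> 1"
  shows "schurQ_fract lam m = to_fract (pfaffian_Q (one_row variable m) lam)"
proof -
  let ?l = "length lam"
  define F where "F fs = (\<Prod>i<?l. z_var (fs ! i) ^ (lam ! i)) *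
      (\<Prod>i<?l. \<Prod>b\<in>{..<m} - set (take (Suc i) fs).
         (z_var (fs ! i) + z_var b) / (z_var (fs ! i) - z_var b))" for fs
  have summand: "schurQ_summand lam m w = F (map w [0..<?l])" if w: "w permutes {..<m}" for w
  proof -
    have "(\<Prod>j\<in>{i<..<m}. (z_var (w i) + z_var (w j)) / (z_var (w i) - z_var (w j))) =
        (\<Prod>b\<in>{..<m} - set (take (Suc i) (map w [0..<?l])).
           (z_var (w i) + z_var b) / (z_var (w i) - z_var b))" if i: "i < ?l" for i
    proof -
      have "take (Suc i) [0..<?l] = [0..<Suc i]"
        using i by (subst take_upt) auto
      then have T: "set (take (Suc i) (map w [0..<?l])) = w ` {0..<Suc i}"
        by (simp only: take_map set_map set_upt)
      have "{..<m} - w ` {0..<Suc i} = w ` ({..<m} - {0..<Suc i})"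
        unfolding image_set_diff[OF permutes_inj[OF w]] permutes_image[OF w] ..
      also have "{..<m} - {0..<Suc i} = {i<..<m}"
        by auto
      finally show ?thesis
        unfolding T by (simp add: prod.reindex inj_on_subset[OF permutes_inj[OF w]])
    qed
    then have "(\<Prod>i<?l. \<Prod>j\<in>{i<..<m}. (z_var (w i) + z_var (w j)) / (z_var (w i) - z_var (w j))) =
        (\<Prod>i<?l. \<Prod>b\<in>{..<m} - set (take (Suc i) (map w [0..<?l])).
           (z_var (map w [0..<?l] ! i) + z_var b) / (z_var (map w [0..<?l] ! i) - z_var b))"
      by - (rule prod.cong[OF refl], simp)
    moreover have "(\<Prod>i<?l. z_var (w i) ^ (lam ! i)) =
        (\<Prod>i<?l. z_var (map w [0..<?l] ! i) ^ (lam ! i))"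
      by (rule prod.cong[OF refl]) simp
    ultimately show ?thesis
      unfolding schurQ_summand_def F_def by (simp only:)
  qed
  have perm: "(SOME w. w \<in> C) permutes {..<m}" if C: "C \<in> sym_cosets m ?l" for C
  proof -
    obtain w where w: "w permutes {..<m}" "C = (\<lambda>v. w \<circ> v) ` {v. v permutes {?l..<m}}"
      using C unfolding sym_cosets_def by blast
    have "w \<circ> v permutes {..<m}" if "v permutes {?l..<m}" for v
      using that by (intro permutes_compose w permutes_subset[OF that]) auto
    then have "\<forall>w'\<in>C. w' permutes {..<m}"
      unfolding w(2) by blast
    moreover have "C \<noteq> {}"
      unfolding w(2) using permutes_id by blast
    ultimately show ?thesis
      by (simp add: some_in_eq)
  qed
  have "schurQ_fract lam m = 2 ^ ?l * (\<Sum>C\<in>sym_cosets m ?l. F (map (SOME w. w \<in> C) [0..<?l]))"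
    unfolding schurQ_fract_def using summand[OF perm] by (intro arg_cong2[where f = "(*)"] sum.cong) auto
  also have "\<dots> = 2 ^ ?l * (\<Sum>fs | distinct fs \<and> set fs \<subseteq> {..<m} \<and> length fs = ?l. F fs)"
    by (simp only: sum_sym_cosets[OF assms(1)])
  also have "\<dots> = z_var.tuple_sum m lam"
    unfolding z_var.sum_distinct_tuples[symmetric] F_def sum_distrib_left ..
  also have "\<dots> = pfaffian_Q (one_row z_var m) lam"
    by (rule z_var.tuple_sum_eq_pfaffian[OF assms(2)])
  also have "\<dots> = to_fract (pfaffian_Q (one_row variable m) lam)"
    unfolding to_fract_hom.hom_pfaffian_Q to_fract_hom.hom_one_row z_var_def ..
  finally show ?thesis .
qed

lemma schurQ_poly_eq_pfaffian:
  assumes "length lam \<le> m" "\<And>r. r \<in> set lam \<Longrightarrow> r \<ge> 1"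
  shows "schurQ_poly lam m = pfaffian_Q (one_row variable m) lam"
proof -
  have "schurQ_fract lam m = to_fract (pfaffian_Q (one_row variable m) lam)"
    using assms by (rule schurQ_fract_eq_pfaffian)
  then show ?thesis
    unfolding schurQ_poly_def by simp
qed

lemma lookup_variable_mult_eq_0:
  assumes "Poly_Mapping.lookup a m = 0"
  shows "Poly_Mapping.lookup (variable m * p) a = 0"
proof -
  have "Poly_Mapping.lookup (variable m) b * (\<Sum>c. Poly_Mapping.lookup p c when a = b + c) = 0" for b
  proof (cases "b = Poly_Mapping.single m 1")
    case True
    have "a \<noteq> b + c" for c
      using assms by (auto simp: True lookup_add)
    then show ?thesis by simp
  next
    case False
    then show ?thesis
      by (simp add: variable_def lookup_single_not_eq)
  qed
  then show ?thesis
    unfolding lookup_mult by (simp only: Sum_any.neutral)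
qed

lemma one_row_Suc_cong: "z m dvd one_row z (Suc m) r - one_row z m r"
proof -
  have "one_row z (Suc m) r =
      (\<Sum>i\<in>{0..<r}. one_row z m i * fps_nth (gen_factor (z m)) (r - i)) + one_row z m r"
    by (simp add: one_row_Suc gen_factor_def flip: atLeastLessThanSuc_atLeastAtMost)
  moreover have "z m dvd one_row z m i * fps_nth (gen_factor (z m)) (r - i)" if "i \<in> {0..<r}" for i
    using that by (cases "r - i") (auto simp: gen_factor_def)
  ultimately show ?thesis
    by (metis (no_types, lifting) add_diff_cancel_right' dvd_sum)
qed

text \<open>
  Adjoining the variable \<open>z\<^sub>m\<close> changes the one-row functions, and with them the Pfaffian expression, by
  multiples of \<open>z\<^sub>m\<close>; such multiples contain no monomial in which \<open>z\<^sub>m\<close> does not occur.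
\<close>

lemma lookup_pfaffian_stable:
  assumes "\<And>i. i \<in> Poly_Mapping.keys a \<Longrightarrow> i < m" "m \<le> m'"
  shows "Poly_Mapping.lookup (pfaffian_Q (one_row variable m') lam) a =
    Poly_Mapping.lookup (pfaffian_Q (one_row variable m) lam) a"
  using assms(2)
proof (induction m' rule: dec_induct)
  case (step m')
  have "variable m' dvd pfaffian_Q (one_row variable (Suc m')) lam - pfaffian_Q (one_row variable m') lam"
    by (intro pfaffian_Q_cong one_row_Suc_cong)
  then obtain p where p: "pfaffian_Q (one_row variable (Suc m')) lam - pfaffian_Q (one_row variable m') lam =
      variable m' * p" ..
  have "Poly_Mapping.lookup a m' = 0"
    using assms(1)[of m'] step(1) by (auto simp: in_keys_iff)
  from lookup_variable_mult_eq_0[OF this, of p] show ?case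
    unfolding p[symmetric] by (simp add: lookup_minus step.IH)
qed simp

lemma schurQ_eq_lookup:
  assumes "\<And>i. i \<in> Poly_Mapping.keys a \<Longrightarrow> i < m" "\<And>r. r \<in> set lam \<Longrightarrow> r \<ge> 1"
  shows "schurQ lam a = Poly_Mapping.lookup (pfaffian_Q (one_row variable m) lam) a"
proof -
  let ?c = "Poly_Mapping.lookup (pfaffian_Q (one_row variable m) lam) a"
  have "\<forall>\<^sub>F m' in sequentially. Poly_Mapping.lookup (schurQ_poly lam m') a = ?c"
    using eventually_ge_at_top[of "max m (length lam)"]
  proof eventually_elim
    case (elim m')
    then show ?case
      using assms by (simp add: schurQ_poly_eq_pfaffian lookup_pfaffian_stable)
  qed
  moreover have "c = ?c" if "\<forall>\<^sub>F m' in sequentially. Poly_Mapping.lookup (schurQ_poly lam m') a = c" for c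
  proof -
    have "\<forall>\<^sub>F m' in sequentially. c = ?c"
      using that calculation by eventually_elim simp
    then show ?thesis by simp
  qed
  ultimately show ?thesis
    unfolding schurQ_def by (rule the_equality)
qed

definition spec_exponent :: "monomial \<Rightarrow> nat" where
  "spec_exponent a = (\<Sum>i\<in>Poly_Mapping.keys a. i * Poly_Mapping.lookup a i)"

lemma spec_exponent_add: "spec_exponent (a + b) = spec_exponent a + spec_exponent b"
  unfolding spec_exponent_def by (rule setsum_keys_plus_distrib) (simp_all add: distrib_left)

text \<open>
  A monomial that is sent to \<open>t ^ k\<close> involves only the variables \<open>z\<^sub>0, \<dots>, z\<^sub>k\<close>. Hence the coefficient of
  \<open>t ^ k\<close> in the principal specialization can be read off from finitely many variables.
\<close>

lemma spec_exponent_bound: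
  assumes "i \<in> Poly_Mapping.keys a"
  shows "i \<le> spec_exponent a"
proof -
  have "i \<le> i * Poly_Mapping.lookup a i"
    using assms by (cases "Poly_Mapping.lookup a i") (auto simp: in_keys_iff)
  also have "\<dots> \<le> spec_exponent a"
    unfolding spec_exponent_def using assms by (intro member_le_sum) auto
  finally show ?thesis .
qed

text \<open>
  The substitution \<open>z\<^sub>i := t ^ i\<close> on polynomials.
\<close>

definition spec_poly :: "mpolynomial \<Rightarrow> rat fps" where
  "spec_poly p = (\<Sum>a\<in>Poly_Mapping.keys p. fps_const (Poly_Mapping.lookup p a) * fps_X ^ spec_exponent a)"

lemma spec_poly_add: "spec_poly (p + q) = spec_poly p + spec_poly q"
  unfolding spec_poly_def
  by (rule setsum_keys_plus_distrib) (simp_all add: distrib_right flip: fps_const_add)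

lemma spec_poly_single: "spec_poly (Poly_Mapping.single a c) = fps_const c * fps_X ^ spec_exponent a"
  by (cases "c = 0") (simp_all add: spec_poly_def)

lemma spec_poly_sum: "spec_poly (sum f A) = (\<Sum>x\<in>A. spec_poly (f x))"
  by (induction A rule: infinite_finite_induct) (auto simp: spec_poly_add spec_poly_def[of 0])

lemma sum_of_monomials: "p = (\<Sum>a\<in>Poly_Mapping.keys p. Poly_Mapping.single a (Poly_Mapping.lookup p a))"
  by (rule poly_mapping_eqI) (simp add: lookup_sum lookup_single when_def in_keys_iff)

lemma spec_poly_mult: "spec_poly (p * q) = spec_poly p * spec_poly q"
proof -
  have "p * q = (\<Sum>a\<in>Poly_Mapping.keys p. \<Sum>b\<in>Poly_Mapping.keys q.
      Poly_Mapping.single (a + b) (Poly_Mapping.lookup p a * Poly_Mapping.lookup q b))"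
    by (subst (1) sum_of_monomials[of p], subst (1) sum_of_monomials[of q])
      (simp add: sum_product mult_single)
  then have "spec_poly (p * q) = (\<Sum>a\<in>Poly_Mapping.keys p. \<Sum>b\<in>Poly_Mapping.keys q.
      spec_poly (Poly_Mapping.single (a + b) (Poly_Mapping.lookup p a * Poly_Mapping.lookup q b)))"
    by (simp add: spec_poly_sum)
  also have "\<dots> = spec_poly p * spec_poly q"
    unfolding spec_poly_def[of p] spec_poly_def[of q] sum_product spec_poly_single
    by (intro sum.cong refl) (simp add: spec_exponent_add power_add mult_ac flip: fps_const_mult)
  finally show ?thesis .
qed

interpretation spec_poly: comm_ring_hom spec_poly
proof
  show "spec_poly 1 = 1"
    by (simp add: spec_poly_single spec_exponent_def flip: single_one)
qed (fact spec_poly_add spec_poly_mult)+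

lemma spec_poly_variable: "spec_poly (variable i) = fps_X ^ i"
  by (simp add: variable_def spec_poly_single spec_exponent_def)

lemma spec_poly_nth:
  "fps_nth (spec_poly p) k = (\<Sum>a | a \<in> Poly_Mapping.keys p \<and> spec_exponent a = k. Poly_Mapping.lookup p a)"
proof -
  have "fps_nth (spec_poly p) k =
      (\<Sum>a\<in>Poly_Mapping.keys p. if spec_exponent a = k then Poly_Mapping.lookup p a else 0)"
    unfolding spec_poly_def fps_sum_nth by (intro sum.cong) (auto simp: fps_X_power_nth)
  then show ?thesis
    by (simp add: sum.inter_filter)
qed

lemma principal_spec_schurQ_nth:
  assumes "k < m" "\<And>r. r \<in> set lam \<Longrightarrow> r \<ge> 1"
  shows "fps_nth (principal_spec (schurQ lam)) k =
    fps_nth (pfaffian_Q (one_row (\<lambda>i. fps_X ^ i) m) lam) k"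
proof -
  let ?P = "pfaffian_Q (one_row variable m) lam"
  have eq: "schurQ lam a = Poly_Mapping.lookup ?P a" if "spec_exponent a = k" for a
    using assms that spec_exponent_bound[of _ a] by (intro schurQ_eq_lookup) (auto intro: le_less_trans)
  have "fps_nth (principal_spec (schurQ lam)) k =
      (\<Sum>a | schurQ lam a \<noteq> 0 \<and> spec_exponent a = k. schurQ lam a)"
    by (simp add: principal_spec_def spec_exponent_def)
  also have "\<dots> = (\<Sum>a | a \<in> Poly_Mapping.keys ?P \<and> spec_exponent a = k. Poly_Mapping.lookup ?P a)"
    by (intro sum.cong) (auto simp: eq in_keys_iff)
  also have "\<dots> = fps_nth (spec_poly ?P) k"
    by (rule spec_poly_nth[symmetric])
  also have "spec_poly ?P = pfaffian_Q (one_row (\<lambda>i. fps_X ^ i) m) lam"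
    by (simp only: spec_poly.hom_pfaffian_Q spec_poly.hom_one_row spec_poly_variable)
  finally show ?thesis .
qed

section \<open>Principal specialization of the one-row functions\<close>

text \<open>
  The substitution of \<open>t y\<close> for the variable \<open>y\<close> of the power series.
\<close>

definition fps_scale :: "'a::comm_ring_1 \<Rightarrow> 'a fps \<Rightarrow> 'a fps" where
  "fps_scale t F = Abs_fps (\<lambda>r. t ^ r * fps_nth F r)"

lemma fps_scale_mult: "fps_scale t (F * G) = fps_scale t F * fps_scale t G"
proof (rule fps_ext)
  fix n
  have "t ^ n * (fps_nth F i * fps_nth G (n - i)) =
      (t ^ i * fps_nth F i) * (t ^ (n - i) * fps_nth G (n - i))" if "i \<in> {0..n}" for i
    using that by (simp add: mult_ac flip: power_add)
  then show "fps_nth (fps_scale t (F * G)) n = fps_nth (fps_scale t F * fps_scale t G) n"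
    unfolding fps_mult_nth fps_scale_def fps_nth_Abs_fps sum_distrib_left by (rule sum.cong[OF refl])
qed

lemma fps_scale_gen_factor: "fps_scale t (gen_factor c) = gen_factor (t * c)"
  by (rule fps_ext) (simp add: fps_scale_def gen_factor_def power_mult_distrib mult_ac)

lemma fps_scale_prod_gen_factor:
  fixes m :: nat
  shows "fps_scale t (\<Prod>a<m. gen_factor (z a)) = (\<Prod>a<m. gen_factor (t * z a))"
proof (induction m)
  case 0
  show ?case
    by (rule fps_ext) (simp add: fps_scale_def)
qed (simp add: fps_scale_mult fps_scale_gen_factor)

text \<open>
  Let \<open>F(y) = \<Prod>a<m. (1 + t ^ a y) / (1 - t ^ a y)\<close>. The products \<open>F(y)\<close> and \<open>F(t y)\<close> have all factors in
  common except for the first one of \<open>F(y)\<close> and the last one of \<open>F(t y)\<close>. The latter is the factor of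
  \<open>t ^ m\<close>, which is 1 modulo \<open>t ^ m\<close>, so that \<open>(1 - y) F(y) = (1 + y) F(t y)\<close> modulo \<open>t ^ m\<close>.
\<close>

lemma one_row_principal_recurrence:
  fixes t :: "'a::comm_ring_1" and m :: nat
  defines "q \<equiv> one_row (\<lambda>i. t ^ i) m"
  shows "t ^ m dvd (1 - t ^ Suc r) * q (Suc r) - (1 + t ^ r) * q r"
proof -
  define F where "F = (\<Prod>a<m. gen_factor (t ^ a))"
  define H where "H = Abs_fps (\<lambda>n. if n = 0 then 0 else 2 * t ^ (m * (n - 1)))"
  have gen: "gen_factor (t ^ m) = 1 + fps_const (t ^ m) * H"
  proof (rule fps_ext)
    fix n show "fps_nth (gen_factor (t ^ m)) n = fps_nth (1 + fps_const (t ^ m) * H) n"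
      by (cases n) (simp_all add: gen_factor_def H_def power_add mult_ac flip: power_mult)
  qed
  \<comment> \<open>Both sides are the product of the factors of \<open>t ^ a\<close> for all \<open>a \<le> m\<close>.\<close>
  have "F * gen_factor (t ^ m) = gen_factor 1 * fps_scale t F"
    unfolding F_def fps_scale_prod_gen_factor
    using prod.lessThan_Suc[of "\<lambda>a. gen_factor (t ^ a)" m]
      prod.lessThan_Suc_shift[of "\<lambda>a. gen_factor (t ^ a)" m] by simp
  then have "(1 - fps_X) * (F * gen_factor (t ^ m)) =
      (gen_factor 1 * (1 - fps_const 1 * fps_X)) * fps_scale t F"
    by (simp add: mult_ac)
  then have "(1 - fps_X) * F - (1 + fps_X) * fps_scale t F =
      - (fps_const (t ^ m) * ((1 - fps_X) * F * H))"
    unfolding gen_factor_mult gen by (simp add: algebra_simps)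
  then have "fps_nth ((1 - fps_X) * F - (1 + fps_X) * fps_scale t F) (Suc r) =
      - (t ^ m * fps_nth ((1 - fps_X) * F * H) (Suc r))"
    by simp
  also have "fps_nth ((1 - fps_X) * F - (1 + fps_X) * fps_scale t F) (Suc r) =
      (1 - t ^ Suc r) * q (Suc r) - (1 + t ^ r) * q r"
    unfolding q_def one_row_def F_def[symmetric]
    by (simp add: left_diff_distrib distrib_right fps_scale_def)
  finally show ?thesis
    by simp
qed

text \<open>
  The principal specialization of the one-row functions in infinitely many variables,
  \<open>\<Prod>i<r. (1 + t ^ i) / (1 - t ^ (i + 1))\<close>.
\<close>

primrec principal_one_row :: "nat \<Rightarrow> rat fps" where
  "principal_one_row 0 = 1"
| "principal_one_row (Suc r) = inverse (1 - fps_X ^ Suc r) * ((1 + fps_X ^ r) * principal_one_row r)"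

lemma principal_one_row_Suc:
  "(1 - fps_X ^ Suc r) * principal_one_row (Suc r) = (1 + fps_X ^ r) * principal_one_row r"
proof -
  have "(1 - fps_X ^ Suc r) * inverse (1 - fps_X ^ Suc r :: rat fps) = 1"
    by (rule inverse_mult_eq_1') simp
  then show ?thesis
    by (simp only: principal_one_row.simps mult.assoc[symmetric] mult_1_left)
qed

lemma one_row_principal_cong:
  "fps_X ^ m dvd one_row (\<lambda>i. fps_X ^ i) m r - principal_one_row r"
proof (induction r)
  case (Suc r)
  let ?q = "one_row (\<lambda>i. fps_X ^ i :: rat fps) m"
  have "(1 - fps_X ^ Suc r) * (?q (Suc r) - principal_one_row (Suc r)) =
      ((1 - fps_X ^ Suc r) * ?q (Suc r) - (1 + fps_X ^ r) * ?q r) +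
      (1 + fps_X ^ r) * (?q r - principal_one_row r)"
    using principal_one_row_Suc[of r]
    by (simp only: right_diff_distrib add_diff_eq diff_add_cancel)
  also have "fps_X ^ m dvd \<dots>"
    by (intro dvd_add one_row_principal_recurrence dvd_mult Suc.IH)
  finally have "fps_X ^ m dvd (1 - fps_X ^ Suc r) * (?q (Suc r) - principal_one_row (Suc r))" .
  moreover have "(1 - fps_X ^ Suc r :: rat fps) dvd 1"
    by (simp add: fps_is_unit_iff)
  ultimately show ?case
    by (simp only: dvd_mult_unit_iff')
qed simp

text \<open>
  The coefficient of \<open>t ^ k\<close> is the one for \<open>k + 1\<close> variables, where the one-row functions agree with
  their limits modulo \<open>t ^ (k + 1)\<close>.
\<close>

lemma principal_spec_schurQ:
  assumes "\<And>r. r \<in> set lam \<Longrightarrow> r \<ge> 1"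
  shows "principal_spec (schurQ lam) = pfaffian_Q principal_one_row lam"
proof (rule fps_ext)
  fix k
  have "fps_X ^ Suc k dvd pfaffian_Q (one_row (\<lambda>i. fps_X ^ i) (Suc k)) lam - pfaffian_Q principal_one_row lam"
    by (intro pfaffian_Q_cong one_row_principal_cong)
  then obtain g where "pfaffian_Q (one_row (\<lambda>i. fps_X ^ i) (Suc k)) lam - pfaffian_Q principal_one_row lam =
      fps_X ^ Suc k * g" ..
  then have "fps_nth (pfaffian_Q (one_row (\<lambda>i. fps_X ^ i) (Suc k)) lam - pfaffian_Q principal_one_row lam) k = 0"
    by (simp only: fps_X_power_mult_nth) simp
  then show "fps_nth (principal_spec (schurQ lam)) k = fps_nth (pfaffian_Q principal_one_row lam) k"
    using principal_spec_schurQ_nth[of k "Suc k" lam] assms by simp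
qed

section \<open>Product formula for the specialized Pfaffian\<close>

lemma prod_list_delete_nth:
  fixes f :: "'a \<Rightarrow> 'b::comm_monoid_mult"
  assumes "j < length xs"
  shows "(\<Prod>x\<leftarrow>xs. f x) = f (xs ! j) * (\<Prod>x\<leftarrow>delete_nth j xs. f x)"
  using assms by (subst id_take_nth_drop[OF assms]) (simp add: delete_nth_def mult_ac)

text \<open>
  The recursion of the specialized one-row functions at a point of a field that is not a root of
  unity. Working in a field gives access to Schur's Pfaffian; the indeterminate of the field of Laurent
  series is such a point.
\<close>

locale principal_point =
  fixes t :: "'a::field" and q :: "nat \<Rightarrow> 'a"
  assumes two: "(2::'a) \<noteq> 0"
    and t: "k \<ge> 1 \<Longrightarrow> t ^ k \<noteq> 1"
    and q_0: "q 0 = 1"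
    and q_Suc: "(1 - t ^ Suc r) * q (Suc r) = (1 + t ^ r) * q r"
begin

text \<open>
  The Cayley transform of \<open>t ^ r\<close>. It is chosen because it turns \<open>schur_factor\<close> into
  \<open>(t ^ s - t ^ r) / (1 - t ^ (r + s))\<close>, the shape that the two-row functions take.
\<close>

definition cayley :: "nat \<Rightarrow> 'a" where
  "cayley r = (1 + t ^ r) / (1 - t ^ r)"

lemma q_mult: "q r * (\<Prod>k\<in>{1..r}. 1 - t ^ k) = (\<Prod>i<r. 1 + t ^ i)"
proof (induction r)
  case (Suc r)
  have "q (Suc r) * (\<Prod>k\<in>{1..Suc r}. 1 - t ^ k) =
      ((1 - t ^ Suc r) * q (Suc r)) * (\<Prod>k\<in>{1..r}. 1 - t ^ k)"
    by (simp add: prod.nat_ivl_Suc' mult_ac)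
  also have "\<dots> = (1 + t ^ r) * (q r * (\<Prod>k\<in>{1..r}. 1 - t ^ k))"
    unfolding q_Suc by (simp only: mult.assoc)
  finally show ?case
    unfolding Suc.IH by (simp add: mult.commute)
qed (simp add: q_0)

lemma cayley_add:
  assumes "r \<ge> 1" "s \<ge> 1"
  shows "cayley r + cayley s = 2 * (1 - t ^ (r + s)) / ((1 - t ^ r) * (1 - t ^ s))"
  using t[OF assms(1)] t[OF assms(2)] unfolding cayley_def
  by (simp add: add_frac_eq power_add) (simp add: algebra_simps)

lemma cayley_add_nonzero: "r \<ge> 1 \<Longrightarrow> s \<ge> 1 \<Longrightarrow> cayley r + cayley s \<noteq> 0"
  using two t[of r] t[of s] t[of "r + s"] by (simp add: cayley_add)

lemma schur_factor_cayley:
  assumes "r \<ge> 1" "s \<ge> 1"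
  shows "schur_factor (cayley r) (cayley s) = (t ^ s - t ^ r) / (1 - t ^ (r + s))"
proof -
  have diff: "cayley s - cayley r = 2 * (t ^ s - t ^ r) / ((1 - t ^ r) * (1 - t ^ s))"
    using t[OF assms(1)] t[OF assms(2)] unfolding cayley_def
    by (simp add: diff_frac_eq) (simp add: algebra_simps)
  have cancel: "2 * u / d / (2 * v / d) = u / v" if "d \<noteq> 0" for u v d :: 'a
    using that two by simp
  show ?thesis
    unfolding schur_factor_def cayley_add[OF assms] diff
    using t[OF assms(1)] t[OF assms(2)] by (intro cancel) simp
qed

lemma two_row_principal:
  assumes "r \<ge> 1"
  shows "two_row q r s = q r * q s * ((t ^ s - t ^ r) / (1 - t ^ (r + s)))"
  using assms
proof (induction s arbitrary: r)
  case 0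
  then show ?case
    using t[of r] by (simp add: q_0)
next
  case (Suc s)
  define R S D where "R = t ^ r" and "S = t ^ s" and "D = 1 - t ^ Suc (r + s)"
  have D: "D \<noteq> 0"
    using t[of "Suc (r + s)"] by (simp add: D_def)
  have D_eq: "D = 1 - t * R * S"
    by (simp add: D_def R_def S_def power_add mult_ac)
  have qr: "(1 - t * R) * q (Suc r) = (1 + R) * q r"
    using q_Suc[of r] by (simp add: R_def)
  have qs: "(1 - t * S) * q (Suc s) = (1 + S) * q s"
    using q_Suc[of s] by (simp add: S_def)
  have "two_row q (Suc r) s = q (Suc r) * q s * ((S - t * R) / D)"
    using Suc.IH[of "Suc r"] by (simp add: R_def S_def D_def)
  then have "two_row q r (Suc s) * D = (q r * q (Suc s) - q (Suc r) * q s) * D - q (Suc r) * q s * (S - t * R)"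
    using D by (simp add: left_diff_distrib)
  also have "\<dots> = q r * q (Suc s) * (t * S - R)"
    unfolding D_eq using qr qs by algebra
  finally show ?case
    using D by (simp add: field_simps R_def S_def D_def)
qed

text \<open>
  Every term of the expansion of \<open>pfaffian_Q\<close> contains each \<open>q r\<close> with \<open>r\<close> a part of \<open>lam\<close> exactly once; what
  remains is Schur's expansion for the points \<open>cayley r\<close>.
\<close>

lemma pfaffian_Q_principal:
  assumes "\<And>r. r \<in> set lam \<Longrightarrow> r \<ge> 1"
  shows "pfaffian_Q q lam = (\<Prod>r\<leftarrow>lam. q r) * schur_prod (map cayley lam)"
  using assms
proof (induction lam rule: measure_induct_rule[of length])
  case (less lam)
  show ?case
  proof (cases lam)
    case (Cons r mu)
    have mu: "s \<ge> 1" if "s \<in> set mu" for s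
      using less.prems that by (simp add: Cons)
    have r: "r \<ge> 1"
      using less.prems by (simp add: Cons)
    have IH: "pfaffian_Q q mu = (\<Prod>r\<leftarrow>mu. q r) * schur_prod (map cayley mu)"
      using mu by (intro less.IH) (auto simp: Cons)
    have term_eq: "two_row q r (mu ! j) * pfaffian_Q q (delete_nth j mu) =
        q r * (\<Prod>r\<leftarrow>mu. q r) *
        (schur_factor (cayley r) (map cayley mu ! j) * schur_prod (delete_nth j (map cayley mu)))"
      if j: "j < length mu" for j
    proof -
      have "mu ! j \<ge> 1"
        using j by (intro mu) simp
      then have "two_row q r (mu ! j) = q r * q (mu ! j) * schur_factor (cayley r) (cayley (mu ! j))"
        by (simp only: two_row_principal[OF r] schur_factor_cayley[OF r])
      moreover have "pfaffian_Q q (delete_nth j mu) =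
          (\<Prod>r\<leftarrow>delete_nth j mu. q r) * schur_prod (map cayley (delete_nth j mu))"
        using j mu set_delete_nth[of j mu] by (intro less.IH) (auto simp: Cons subset_iff)
      ultimately show ?thesis
        using j by (simp add: prod_list_delete_nth[OF j, of q] map_delete_nth mult_ac)
    qed
    have "pfaffian_Q q lam = of_bool (even (length mu)) * q r * pfaffian_Q q mu +
        (\<Sum>j<length mu. (-1) ^ j * (two_row q r (mu ! j) * pfaffian_Q q (delete_nth j mu)))"
      by (simp add: Cons mult.assoc)
    also have "\<dots> = of_bool (even (length mu)) * q r * ((\<Prod>r\<leftarrow>mu. q r) * schur_prod (map cayley mu)) +
        (\<Sum>j<length mu. (-1) ^ j * (q r * (\<Prod>r\<leftarrow>mu. q r) *
          (schur_factor (cayley r) (map cayley mu ! j) * schur_prod (delete_nth j (map cayley mu)))))"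
      using term_eq by (simp add: IH)
    also have "\<dots> = q r * (\<Prod>r\<leftarrow>mu. q r) *
        (of_bool (even (length (map cayley mu))) * schur_prod (map cayley mu) +
        (\<Sum>j<length (map cayley mu). (-1) ^ j * schur_factor (cayley r) (map cayley mu ! j) *
           schur_prod (delete_nth j (map cayley mu))))"
      by (simp add: distrib_left sum_distrib_left mult_ac)
    also have "\<dots> = q r * (\<Prod>r\<leftarrow>mu. q r) * schur_prod (cayley r # map cayley mu)"
    proof -
      have sub: "set (cayley r # map cayley mu) \<subseteq> cayley ` {1..}"
        using r mu by auto
      have nz: "x + y \<noteq> 0"
        if xy: "x \<in> set (cayley r # map cayley mu)" "y \<in> set (cayley r # map cayley mu)" for x y
      proof -
        obtain u v where "u \<ge> 1" "v \<ge> 1" "x = cayley u" "y = cayley v"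
          using xy sub by blast
        then show ?thesis
          by (simp only: cayley_add_nonzero not_False_eq_True)
      qed
      show ?thesis
        by (simp only: schur_pfaffian[OF nz])
    qed
    finally show ?thesis
      by (simp add: Cons)
  qed simp
qed

end

section \<open>Hook lengths of the shifted diagram\<close>

lemma strict_decreasing_gap:
  fixes lam :: "nat list"
  assumes "sorted_wrt (>) lam" "i \<le> k" "k < length lam"
  shows "lam ! k + k \<le> lam ! i + i"
  using assms(2,3)
proof (induction k rule: dec_induct)
  case (step k)
  have "lam ! Suc k < lam ! k"
    using assms(1) step by (simp add: sorted_wrt_iff_nth_less)
  then show ?case
    using step by simp
qed simp

context
  fixes lam :: "nat list" and i :: nat
  assumes sorted: "sorted_wrt (>) lam" and pos: "\<And>p. p \<in> set lam \<Longrightarrow> p > 0" and i: "i < length lam"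
begin

lemma arm_set:
  assumes "i < c"
  shows "{j'. c < j' \<and> (i, j') \<in> double_diagram lam} = {c<..i + lam ! i}"
  using assms i by (auto simp: double_diagram_def frobenius_diagram_def)

text \<open>
  The hook lengths of row \<open>i\<close> are computed by the column \<open>c\<close> of the double diagram. A column
  \<open>c < length lam\<close> meets the diagonal, so below row \<open>i\<close> it is filled down to the end of the leg of \<open>(c, c)\<close>.
\<close>

lemma shifted_hook_left:
  assumes c: "i < c" "c < length lam"
  shows "shifted_hook_length lam (i, c - 1) = lam ! i + lam ! c"
proof -
  have pos_c: "lam ! c > 0"
    using c by (intro pos) simp
  have gap: "lam ! c + c \<le> lam ! i' + i'" if "i' \<le> c" for i'
    using strict_decreasing_gap[OF sorted that c(2)] .
  have "{i'. i < i' \<and> (i', c) \<in> double_diagram lam} = {i<..c + (lam ! c - 1)}"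
  proof (intro equalityI subsetI)
    fix i' assume "i' \<in> {i'. i < i' \<and> (i', c) \<in> double_diagram lam}"
    then show "i' \<in> {i<..c + (lam ! c - 1)}"
      using c by (auto simp: double_diagram_def frobenius_diagram_def)
  next
    fix i' assume i': "i' \<in> {i<..c + (lam ! c - 1)}"
    show "i' \<in> {i'. i < i' \<and> (i', c) \<in> double_diagram lam}"
      using i' c pos_c gap[of i'] by (cases i' c rule: linorder_cases)
        (auto simp: double_diagram_def frobenius_diagram_def)
  qed
  moreover have "c \<le> i + lam ! i"
    using gap[of i] c by simp
  ultimately show ?thesis
    using c pos_c by (simp add: shifted_hook_length_def hook_length_def arm_set)
qed

text \<open>
  The rows below row \<open>i\<close> that reach column \<open>c\<close>, for a column beyond the last diagonal cell.
\<close>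

definition long_rows :: "nat \<Rightarrow> nat set" where
  "long_rows c = {k\<in>{i<..<length lam}. c \<le> k + lam ! k}"

lemma shifted_hook_right:
  assumes c: "length lam \<le> c" "c \<le> i + lam ! i"
  shows "shifted_hook_length lam (i, c - 1) = i + lam ! i - c + card (long_rows c) + 1"
proof -
  have "{i'. i < i' \<and> (i', c) \<in> double_diagram lam} = long_rows c"
    using c by (auto simp: double_diagram_def frobenius_diagram_def long_rows_def)
  then show ?thesis
    using c i by (simp add: shifted_hook_length_def hook_length_def arm_set)
qed

lemma length_le: "length lam \<le> i + lam ! i"
proof -
  have "lam ! (length lam - 1) + (length lam - 1) \<le> lam ! i + i"
    using i by (intro strict_decreasing_gap[OF sorted]) auto
  moreover have "lam ! (length lam - 1) > 0"
    using i by (intro pos) simp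
  ultimately show ?thesis by simp
qed

text \<open>
  This says that a hook length in a column \<open>c \<ge> length lam\<close> is never a difference \<open>lam ! i - lam ! k\<close>. The
  rows that reach column \<open>c\<close> are the first ones below row \<open>i\<close>, so their number is at least \<open>k - i\<close> or less
  than \<open>k - i\<close>, depending on whether row \<open>k\<close> reaches column \<open>c\<close>; either way equality fails.
\<close>

lemma card_long_rows_neq:
  assumes k: "k \<in> {i<..<length lam}"
  shows "card (long_rows c) + lam ! k + i + 1 \<noteq> c"
proof (cases "c \<le> k + lam ! k")
  case True
  have "{i<..k} \<subseteq> long_rows c"
  proof
    fix k' assume k': "k' \<in> {i<..k}"
    then have "lam ! k + k \<le> lam ! k' + k'"
      using k by (intro strict_decreasing_gap[OF sorted]) auto
    then show "k' \<in> long_rows c"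
      using k k' True by (auto simp: long_rows_def)
  qed
  then have "card {i<..k} \<le> card (long_rows c)"
    by (intro card_mono) (auto simp: long_rows_def)
  then show ?thesis
    using k True by auto
next
  case False
  have "long_rows c \<subseteq> {i<..<k}"
  proof
    fix k' assume k': "k' \<in> long_rows c"
    have "k' < k"
    proof (rule ccontr)
      assume "\<not> k' < k"
      then have "lam ! k' + k' \<le> lam ! k + k"
        using k' by (intro strict_decreasing_gap[OF sorted]) (auto simp: long_rows_def)
      then show False
        using k' False \<open>\<not> k' < k\<close> by (auto simp: long_rows_def)
    qed
    then show "k' \<in> {i<..<k}"
      using k' by (auto simp: long_rows_def)
  qed
  then have "card (long_rows c) \<le> card {i<..<k}"
    by (intro card_mono) auto
  then show ?thesis
    using k False by auto
qed

lemma card_long_rows_le: "card (long_rows c) \<le> length lam - i - 1"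
proof -
  have "card (long_rows c) \<le> card {i<..<length lam}"
    by (intro card_mono) (auto simp: long_rows_def)
  then show ?thesis by simp
qed

text \<open>
  The hook lengths in the columns \<open>c \<ge> length lam\<close> decrease strictly with \<open>c\<close>, and they avoid the
  differences \<open>lam ! i - lam ! k\<close>. By counting, they are all the other numbers in \<open>{1..lam ! i}\<close>.
\<close>

lemma right_hooks_image:
  "(\<lambda>c. i + lam ! i - c + card (long_rows c) + 1) ` {length lam..i + lam ! i} =
    {1..lam ! i} - (\<lambda>k. lam ! i - lam ! k) ` {i<..<length lam}"
  (is "?h ` ?C = ?T")
    and inj_on_right_hooks: "inj_on (\<lambda>c. i + lam ! i - c + card (long_rows c) + 1) {length lam..i + lam ! i}"
    and inj_on_differences: "inj_on (\<lambda>k. lam ! i - lam ! k) {i<..<length lam}"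
    and differences_subset: "(\<lambda>k. lam ! i - lam ! k) ` {i<..<length lam} \<subseteq> {1..lam ! i}"
proof -
  have part: "0 < lam ! k \<and> lam ! k < lam ! i" if "k \<in> {i<..<length lam}" for k
    using that pos[of "lam ! k"] strict_decreasing_gap[OF sorted, of i k] by auto
  have decreasing: "lam ! k' < lam ! k" if "k < k'" "k' < length lam" for k k'
    using strict_decreasing_gap[OF sorted, of k k'] that by simp
  show inj_diff: "inj_on (\<lambda>k. lam ! i - lam ! k) {i<..<length lam}"
  proof (rule linorder_inj_onI')
    fix k k' assume "k \<in> {i<..<length lam}" "k' \<in> {i<..<length lam}" "k < k'"
    then show "lam ! i - lam ! k \<noteq> lam ! i - lam ! k'"
      using decreasing[of k k'] part[of k] by auto
  qed
  show sub: "(\<lambda>k. lam ! i - lam ! k) ` {i<..<length lam} \<subseteq> {1..lam ! i}"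
    using part by fastforce
  show inj: "inj_on ?h ?C"
  proof (rule linorder_inj_onI')
    fix c c' assume c: "c \<in> ?C" "c' \<in> ?C" "c < c'"
    have "card (long_rows c') \<le> card (long_rows c)"
      using c by (intro card_mono) (auto simp: long_rows_def)
    then show "?h c \<noteq> ?h c'"
      using c by simp
  qed
  have "?h ` ?C \<subseteq> ?T"
  proof
    fix n assume "n \<in> ?h ` ?C"
    then obtain c where c: "c \<in> ?C" and n: "n = ?h c" by blast
    have "n \<noteq> lam ! i - lam ! k" if k: "k \<in> {i<..<length lam}" for k
    proof
      assume "n = lam ! i - lam ! k"
      then have "i + lam ! i - c + card (long_rows c) + 1 = lam ! i - lam ! k"
        using n by simp
      moreover have "c \<le> i + lam ! i"
        using c by simp
      ultimately show False
        using card_long_rows_neq[OF k, of c] part[OF k] by linarith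
    qed
    then have "n \<notin> (\<lambda>k. lam ! i - lam ! k) ` {i<..<length lam}"
      by blast
    moreover have "n \<le> lam ! i"
      using c n i card_long_rows_le[of c] by auto
    moreover have "n \<ge> 1"
      using n by simp
    ultimately show "n \<in> ?T"
      by simp
  qed
  moreover have "card ?T \<le> card (?h ` ?C)"
  proof -
    have "card ?T = lam ! i - (length lam - i - 1)"
      using sub by (simp add: card_Diff_subset card_image[OF inj_diff])
    also have "\<dots> \<le> card ?C"
      using i length_le by simp
    also have "\<dots> = card (?h ` ?C)"
      by (rule card_image[OF inj, symmetric])
    finally show ?thesis .
  qed
  ultimately show "?h ` ?C = ?T"
    by (intro card_seteq) auto
qed

lemma prod_shifted_hooks_row:
  fixes f :: "nat \<Rightarrow> 'a::comm_monoid_mult"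
  shows "(\<Prod>j\<in>{i..<lam ! i + i}. f (shifted_hook_length lam (i, j))) *
      (\<Prod>k\<in>{i<..<length lam}. f (lam ! i - lam ! k)) =
    (\<Prod>k\<in>{1..lam ! i}. f k) * (\<Prod>k\<in>{i<..<length lam}. f (lam ! i + lam ! k))"
proof -
  let ?h = "\<lambda>c. i + lam ! i - c + card (long_rows c) + 1"
  let ?C = "{length lam..i + lam ! i}" and ?E = "(\<lambda>k. lam ! i - lam ! k) ` {i<..<length lam}"
  have "(\<Prod>j\<in>{i..<lam ! i + i}. f (shifted_hook_length lam (i, j))) =
      (\<Prod>c\<in>{i<..i + lam ! i}. f (shifted_hook_length lam (i, c - 1)))"
    by (rule prod.reindex_bij_witness[of _ "\<lambda>c. c - 1" Suc]) auto
  also have "{i<..i + lam ! i} = {i<..<length lam} \<union> ?C"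
    using i length_le by auto
  also have "(\<Prod>c\<in>{i<..<length lam} \<union> ?C. f (shifted_hook_length lam (i, c - 1))) =
      (\<Prod>c\<in>{i<..<length lam}. f (shifted_hook_length lam (i, c - 1))) *
      (\<Prod>c\<in>?C. f (shifted_hook_length lam (i, c - 1)))"
    by (rule prod.union_disjoint) auto
  also have "(\<Prod>c\<in>{i<..<length lam}. f (shifted_hook_length lam (i, c - 1))) =
      (\<Prod>c\<in>{i<..<length lam}. f (lam ! i + lam ! c))"
    by (intro prod.cong refl arg_cong[where f = f] shifted_hook_left) auto
  also have "(\<Prod>c\<in>?C. f (shifted_hook_length lam (i, c - 1))) = (\<Prod>c\<in>?C. f (?h c))"
    by (intro prod.cong refl arg_cong[where f = f] shifted_hook_right) auto
  also have "\<dots> = prod f ({1..lam ! i} - ?E)"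
    unfolding right_hooks_image[symmetric] by (simp only: prod.reindex[OF inj_on_right_hooks] o_def)
  finally have rows: "(\<Prod>j\<in>{i..<lam ! i + i}. f (shifted_hook_length lam (i, j))) =
      (\<Prod>c\<in>{i<..<length lam}. f (lam ! i + lam ! c)) * prod f ({1..lam ! i} - ?E)" .
  have "(\<Prod>k\<in>{i<..<length lam}. f (lam ! i - lam ! k)) = prod f ?E"
    by (simp add: prod.reindex[OF inj_on_differences])
  moreover have "prod f {1..lam ! i} = prod f ({1..lam ! i} - ?E) * prod f ?E"
    by (rule prod.subset_diff[OF differences_subset]) simp
  ultimately show ?thesis
    unfolding rows by (simp add: mult_ac)
qed

end

lemma prod_triangle_swap:
  fixes f :: "nat \<Rightarrow> nat \<Rightarrow> 'a::comm_monoid_mult"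
  shows "(\<Prod>i<n. \<Prod>k<i. f k i) = (\<Prod>i<n. \<Prod>k\<in>{i<..<n}. f i k)"
proof -
  have "(\<Prod>i<n. \<Prod>k<i. f k i) = (\<Prod>(i, k)\<in>Sigma {..<n} (\<lambda>i. {..<i}). f k i)"
    by (rule prod.Sigma) auto
  also have "\<dots> = (\<Prod>(i, k)\<in>Sigma {..<n} (\<lambda>i. {i<..<n}). f i k)"
    by (rule prod.reindex_bij_witness[of _ prod.swap prod.swap]) auto
  also have "\<dots> = (\<Prod>i<n. \<Prod>k\<in>{i<..<n}. f i k)"
    by (rule prod.Sigma[symmetric]) auto
  finally show ?thesis .
qed

lemma prod_shifted_diagram:
  fixes f :: "nat \<times> nat \<Rightarrow> 'a::comm_monoid_mult"
  shows "prod f (shifted_diagram lam) = (\<Prod>i<length lam. \<Prod>j\<in>{i..<lam ! i + i}. f (i, j))"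
proof -
  have "shifted_diagram lam = Sigma {..<length lam} (\<lambda>i. {i..<lam ! i + i})"
    by (auto simp: shifted_diagram_def)
  then show ?thesis
    by (simp add: prod.Sigma)
qed

section \<open>The hook formula\<close>

context principal_point
begin

text \<open>
  The identity holds row by row: the pairs \<open>i < k\<close> of the product formula are attributed to row \<open>i\<close>, and
  the surplus factors \<open>t ^ (lam ! k)\<close> multiply to \<open>t ^ partition_n lam\<close>, as each \<open>k\<close> occurs for \<open>k\<close> rows \<open>i\<close>.
\<close>

lemma pfaffian_Q_hook_product:
  assumes sorted: "sorted_wrt (>) lam" and pos: "\<And>p. p \<in> set lam \<Longrightarrow> p > 0"
  shows "pfaffian_Q q lam * (\<Prod>c\<in>shifted_diagram lam. 1 - t ^ shifted_hook_length lam c) =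
    t ^ partition_n lam * (\<Prod>c\<in>shifted_diagram lam. 1 + t ^ cell_content c)"
proof -
  let ?l = "length lam"
  let ?K = "\<lambda>i. {i<..<?l}"
  have ge1: "lam ! i \<ge> 1" if "i < ?l" for i
    using pos[of "lam ! i"] that by simp
  have factor: "schur_factor (cayley (lam ! i)) (cayley (lam ! k)) =
      t ^ (lam ! k) * ((1 - t ^ (lam ! i - lam ! k)) / (1 - t ^ (lam ! i + lam ! k)))"
    if "i < ?l" "k \<in> ?K i" for i k
  proof -
    have "lam ! k \<le> lam ! i"
      using strict_decreasing_gap[OF sorted, of i k] that by auto
    then have "t ^ (lam ! i) = t ^ (lam ! k) * t ^ (lam ! i - lam ! k)"
      by (simp flip: power_add)
    then show ?thesis
      using that by (simp add: schur_factor_cayley[OF ge1 ge1] right_diff_distrib)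
  qed
  have row: "q (lam ! i) * (\<Prod>k\<in>?K i. schur_factor (cayley (lam ! i)) (cayley (lam ! k))) *
      (\<Prod>j\<in>{i..<lam ! i + i}. 1 - t ^ shifted_hook_length lam (i, j)) =
      (\<Prod>k\<in>?K i. t ^ (lam ! k)) * (\<Prod>j\<in>{i..<lam ! i + i}. 1 + t ^ cell_content (i, j))"
    if i: "i < ?l" for i
  proof -
    let ?S = "\<Prod>k\<in>?K i. 1 - t ^ (lam ! i + lam ! k)"
    let ?H = "\<Prod>j\<in>{i..<lam ! i + i}. 1 - t ^ shifted_hook_length lam (i, j)"
    let ?D = "\<Prod>k\<in>?K i. 1 - t ^ (lam ! i - lam ! k)"
    let ?N = "\<Prod>k\<in>{1..lam ! i}. 1 - t ^ k"
    have S: "?S \<noteq> 0"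
    proof -
      have "t ^ (lam ! i + lam ! k) \<noteq> 1" if "k \<in> ?K i" for k
        using ge1[OF i] by (intro t) simp
      then show ?thesis by auto
    qed
    have "(\<Prod>k\<in>?K i. schur_factor (cayley (lam ! i)) (cayley (lam ! k))) =
        (\<Prod>k\<in>?K i. t ^ (lam ! k)) * (?D / ?S)"
      using factor[OF i] by (simp add: prod.distrib prod_dividef)
    moreover have "?H * ?D = ?N * ?S"
      using prod_shifted_hooks_row[OF sorted pos i, of "\<lambda>k. 1 - t ^ k"] .
    moreover have "(\<Prod>j\<in>{i..<lam ! i + i}. 1 + t ^ cell_content (i, j)) = (\<Prod>c<lam ! i. 1 + t ^ c)"
      by (rule prod.reindex_bij_witness[of _ "\<lambda>c. c + i" "\<lambda>j. j - i"]) (auto simp: cell_content_def)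
    moreover have "q (lam ! i) * ?N = (\<Prod>c<lam ! i. 1 + t ^ c)"
      by (rule q_mult)
    moreover have "u * (w * (d / s)) * h = w * p"
      if "h * d = v * s" "u * v = p" "s \<noteq> 0" for u w d s h p v :: 'a
    proof -
      have "u * (w * (d / s)) * h = u * w * (h * d) / s"
        by (simp add: mult_ac)
      also have "\<dots> = w * (u * v)"
        unfolding that(1) using that(3) by simp
      finally show ?thesis
        unfolding that(2) .
    qed
    ultimately show ?thesis
      using S by simp
  qed
  have "(\<Prod>i<?l. \<Prod>k\<in>?K i. t ^ (lam ! k)) = (\<Prod>k<?l. \<Prod>i<k. t ^ (lam ! k))"
    by (rule prod_triangle_swap[symmetric])
  also have "\<dots> = t ^ partition_n lam"
    by (simp add: partition_n_def power_sum mult.commute flip: power_mult)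
  finally have n: "(\<Prod>i<?l. \<Prod>k\<in>?K i. t ^ (lam ! k)) = t ^ partition_n lam" .
  have "schur_prod (map cayley lam) =
      (\<Prod>i<?l. \<Prod>k<i. schur_factor (cayley (lam ! k)) (cayley (lam ! i)))"
    unfolding schur_prod_nth length_map by (intro prod.cong refl) simp
  also have "\<dots> = (\<Prod>i<?l. \<Prod>k\<in>?K i. schur_factor (cayley (lam ! i)) (cayley (lam ! k)))"
    by (rule prod_triangle_swap)
  finally have "pfaffian_Q q lam =
      (\<Prod>i<?l. q (lam ! i) * (\<Prod>k\<in>?K i. schur_factor (cayley (lam ! i)) (cayley (lam ! k))))"
    using pos by (simp add: pfaffian_Q_principal Suc_le_eq prod.list_conv_set_nth atLeast0LessThan prod.distrib)
  then have "pfaffian_Q q lam * (\<Prod>c\<in>shifted_diagram lam. 1 - t ^ shifted_hook_length lam c) =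
      (\<Prod>i<?l. q (lam ! i) * (\<Prod>k\<in>?K i. schur_factor (cayley (lam ! i)) (cayley (lam ! k))) *
        (\<Prod>j\<in>{i..<lam ! i + i}. 1 - t ^ shifted_hook_length lam (i, j)))"
    by (simp only: prod_shifted_diagram prod.distrib)
  also have "\<dots> = (\<Prod>i<?l. (\<Prod>k\<in>?K i. t ^ (lam ! k)) *
      (\<Prod>j\<in>{i..<lam ! i + i}. 1 + t ^ cell_content (i, j)))"
    by (intro prod.cong[OF refl] row) simp
  also have "\<dots> = t ^ partition_n lam * (\<Prod>c\<in>shifted_diagram lam. 1 + t ^ cell_content c)"
    unfolding prod.distrib n prod_shifted_diagram ..
  finally show ?thesis .
qed

end

interpretation fps_to_fls_hom: comm_ring_hom "fps_to_fls :: rat fps \<Rightarrow> rat fls"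
  by unfold_locales (simp_all add: fls_times_fps_to_fls)

interpretation fls_X: principal_point "fls_X :: rat fls" "\<lambda>r. fps_to_fls (principal_one_row r)"
proof
  show "fls_X ^ k \<noteq> (1 :: rat fls)" if "k \<ge> 1" for k
  proof -
    have "fps_X ^ k \<noteq> (1 :: rat fps)"
      using that by (auto simp: fps_eq_iff fps_X_power_nth intro!: exI[of _ 0])
    then have "fps_to_fls (fps_X ^ k) \<noteq> (1 :: rat fls)"
      by (simp only: fps_to_fls_eq_1_iff not_False_eq_True)
    then show ?thesis
      by (simp add: fps_to_fls_power)
  qed
  show "(1 - fls_X ^ Suc r) * fps_to_fls (principal_one_row (Suc r)) =
      (1 + fls_X ^ r) * fps_to_fls (principal_one_row r)" for r
    using arg_cong[OF principal_one_row_Suc[of r], of fps_to_fls]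
    by (simp only: fls_times_fps_to_fls fps_to_fls_plus fps_to_fls_minus fps_one_to_fls
        fps_to_fls_power fps_X_to_fls)
qed simp_all

theorem theoremB:
  fixes lam :: "nat list" and n :: nat
  assumes "strict_partition lam n"
  shows "principal_spec (schurQ lam) =
    fps_X ^ partition_n lam * (\<Prod>c\<in>shifted_diagram lam. 1 + fps_X ^ cell_content c)
    / (\<Prod>c\<in>shifted_diagram lam. 1 - fps_X ^ shifted_hook_length lam c)"
proof -
  have sorted: "sorted_wrt (>) lam" and pos: "\<And>p. p \<in> set lam \<Longrightarrow> p > 0"
    using assms by (auto simp: strict_partition_def)
  let ?D = "\<Prod>c\<in>shifted_diagram lam. 1 - fps_X ^ shifted_hook_length lam c :: rat fps"
  let ?N = "fps_X ^ partition_n lam * (\<Prod>c\<in>shifted_diagram lam. 1 + fps_X ^ cell_content c) :: rat fps"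
  have hom_prod: "fps_to_fls (prod f A) = (\<Prod>c\<in>A. fps_to_fls (f c))" for f :: "nat \<times> nat \<Rightarrow> rat fps" and A
    by (induction A rule: infinite_finite_induct) (auto simp: fls_times_fps_to_fls)
  have "fps_to_fls (pfaffian_Q principal_one_row lam * ?D) = fps_to_fls ?N"
    using fls_X.pfaffian_Q_hook_product[OF sorted pos]
    by (simp add: fls_times_fps_to_fls hom_prod fps_to_fls_power fps_to_fls_hom.hom_pfaffian_Q)
  then have "pfaffian_Q principal_one_row lam * ?D = ?N"
    by (simp only: fps_to_fls_eq_iff)
  moreover have "principal_spec (schurQ lam) = pfaffian_Q principal_one_row lam"
    using pos by (intro principal_spec_schurQ) (simp add: Suc_le_eq)
  moreover have "?D \<noteq> 0"
  proof -
    have "fps_X ^ shifted_hook_length lam c \<noteq> (1 :: rat fps)" for c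
      by (cases c) (auto simp: shifted_hook_length_def hook_length_def fps_eq_iff fps_X_power_nth intro!: exI[of _ 0])
    then show ?thesis
      by (cases "finite (shifted_diagram lam)") auto
  qed
  ultimately show ?thesis
    by (metis nonzero_mult_div_cancel_right)
qed

end
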